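(* Let $n\ge1$ and let $(\mathcal C,\mathbb E,\mathfrak s)$ be an $n$-exangulated category. Suppose that $\mathcal C$ is weakly idempotent complete or that $n\ge2$. Let $f\colon X\to Y$ and $g\colon Y\to Z$ be morphisms in $\mathcal C$. If $gf\colon X\to Z$ is an $\mathfrak s$-inflation, then $f$ is an $\mathfrak s$-inflation.
   Context: An additive category is weakly idempotent complete if every retraction has a kernel (equivalently, every section has a cokernel). **Complexes.** For an additive category $\mathcal D$, $\mathbf C^{n+2}_{\mathcal D}$ is the category of complexes $X_\bullet\colon X_0\xrightarrow{d^X_0}X_1\to\cdots\to X_n\xrightarrow{d^X_n}X_{n+1}$ over $\mathcal D$ concentrated in degrees $0,\dots,n+1$, with chain maps $f_\bullet=(f_0,\dots,f_{n+1})$. For $A,C\in\mathcal D$, $\mathbf C^{n+2}_{(\mathcal D;A,C)}$ is its subcategory of complexes with $X_0=A$, $X_{n+1}=C$ and chain maps with $f_0=\mathrm{id}_A$, $f_{n+1}=\mathrm{id}_C$; two of its morphisms are homotopic if their difference is null-homotopic as a chain map, and $[X_\bullet]_{\mathcal D}$ is the resulting homotopy equivalence class of $X_\bullet$ in $\mathbf C^{n+2}_{(\mathcal D;A,C)}$. For $X\in\mathcal D$ and $0\le i\le n$, $\mathrm{triv}_i(X)_\bullet$ has $X$ in degrees $i,i+1$ with differential $\mathrm{id}_X$ between them and $0$ elsewhere. **Extensions.** Let $\mathbb G\colon\mathcal D^{\mathrm{op}}\times\mathcal D\to\mathsf{Ab}$ be biadditive. For $\delta\in\mathbb G(C,A)$,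 $a\colon A\to B$, $c\colon D\to C$ write $a_*\delta=\mathbb G(C,a)(\delta)$ and $c^*\delta=\mathbb G(c,A)(\delta)$. For $\delta\in\mathbb G(C,A)$, $\rho\in\mathbb G(D,B)$, a morphism $(a,c)\colon\delta\to\rho$ is a pair $a\colon A\to B$, $c\colon C\to D$ with $a_*\delta=c^*\rho$. An $n$-exangle is a pair $\langle X_\bullet,\delta\rangle$ with $X_\bullet\in\mathbf C^{n+2}_{\mathcal D}$, $\delta\in\mathbb G(X_{n+1},X_0)$, $(d^X_0)_*\delta=0$, $(d^X_n)^*\delta=0$, such that for all $X\in\mathcal D$ the sequences $\mathcal D(X,X_0)\to\cdots\to\mathcal D(X,X_{n+1})\to\mathbb G(X,X_0)$ (last map $f\mapsto f^*\delta$) and $\mathcal D(X_{n+1},X)\to\cdots\to\mathcal D(X_0,X)\to\mathbb G(X_{n+1},X)$ (last map $g\mapsto g_*\delta$) are exact. **Exact realisation.** An exact realisation $\mathfrak r$ of $\mathbb G$ assigns to each $\delta\in\mathbb G(C,A)$ a homotopy equivalence class $\mathfrak r(\delta)$ of an object of $\mathbf C^{n+2}_{(\mathcal D;A,C)}$ such that: (R0) if $[X_\bullet]_{\mathcal D}=\mathfrak r(\delta)$, $[Y_\bullet]_{\mathcal D}=\mathfrak r(\rho)$ and $(a,c)\colon\delta\to\rho$ is a morphism of extensions, there is a chain map $f_\bullet\colon X_\bullet\to Y_\bullet$ (a lift of $(a,c)$) with $f_0=a$, $f_{n+1}=c$; (R1) if $\mathfrak r(\delta)=[X_\bullet]_{\mathcal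 D}$ then $\langle X_\bullet,\delta\rangle$ is an $n$-exangle; (R2) for all $A,C\in\mathcal D$, $\mathfrak r$ sends $0\in\mathbb G(0,A)$ to $[\mathrm{triv}_0(A)_\bullet]_{\mathcal D}$ and $0\in\mathbb G(C,0)$ to $[\mathrm{triv}_n(C)_\bullet]_{\mathcal D}$. If $\mathfrak r(\delta)=[X_\bullet]_{\mathcal D}$, then $\langle X_\bullet,\delta\rangle$ is called $\mathfrak r$-distinguished, $X_\bullet$ an $\mathfrak r$-conflation, $d^X_0$ an $\mathfrak r$-inflation and $d^X_n$ an $\mathfrak r$-deflation. **$n$-exangulated category.** A triple $(\mathcal D,\mathbb G,\mathfrak r)$ with $\mathcal D$ additive, $\mathbb G$ biadditive and $\mathfrak r$ an exact realisation of $\mathbb G$ such that: (EA1) $\mathfrak r$-inflations are closed under composition; (EA1$^{\mathrm{op}}$) $\mathfrak r$-deflations are closed under composition; (EA2) for $c\colon X_{n+1}\to Y_{n+1}$ and $\mathfrak r$-distinguished $\langle X_\bullet,c^*\rho\rangle$, $\langle Y_\bullet,\rho\rangle$ with $A:=X_0=Y_0$, there is a lift $f_\bullet$ of $(\mathrm{id}_A,c)$ such that $\langle M^f_\bullet,(d^X_0)_*\rho\rangle$ is $\mathfrak r$-distinguished, where $M^f_\bullet$ is the complex $X_1\to X_2\oplus Y_1\to\cdots\to X_{n+1}\oplus Y_n\to Y_{n+1}$ with differentials $\begin{bmatrix}-d^X_1\\ f_1\end{bmatrix}$, then $\begin{bmatrix}-d^X_{i}&0\\ f_{i}&d^Y_{i-1}\end{bmatrix}$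 for $i=2,\dots,n$, then $\begin{bmatrix}f_{n+1}&d^Y_n\end{bmatrix}$; (EA2$^{\mathrm{op}}$) for $a\colon X_0\to Y_0$ and $\mathfrak r$-distinguished $\langle X_\bullet,\delta\rangle$, $\langle Y_\bullet,a_*\delta\rangle$ with $C:=X_{n+1}=Y_{n+1}$, there is a lift $f_\bullet$ of $(a,\mathrm{id}_C)$ such that $\langle N^f_\bullet,(d^Y_n)^*\delta\rangle$ is $\mathfrak r$-distinguished, where $N^f_\bullet$ is the complex $X_0\to X_1\oplus Y_0\to\cdots\to X_n\oplus Y_{n-1}\to Y_n$ with differentials $\begin{bmatrix}d^X_0\\ f_0\end{bmatrix}$, then $\begin{bmatrix}d^X_i&0\\ f_i&-d^Y_{i-1}\end{bmatrix}$ for $i=1,\dots,n-1$, then $\begin{bmatrix}f_n&-d^Y_{n-1}\end{bmatrix}$. *)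

theory Defs
  imports "HOL-Algebra.Coset"
begin

section \<open>Additive categories\<close>

text \<open>
  The hom-sets are abelian groups in the sense of \<^const>\<open>comm_group\<close>, whose operation is
  written multiplicatively in the library; the abbreviations \<open>mzero\<close>, \<open>madd\<close>, \<open>mneg\<close> below give
  the additive reading. Composition is in the usual order: \<open>g \<cdot> f\<close> is \<open>f\<close> followed by \<open>g\<close>.
\<close>

record ('o, 'm) precat =
  objects :: "'o set" ("Ob\<index>")
  hom_group :: "'o \<Rightarrow> 'o \<Rightarrow> 'm monoid" ("Hom\<index>")
  compose :: "'m \<Rightarrow> 'm \<Rightarrow> 'm" (infixl "\<cdot>\<index>" 70)
  ident :: "'o \<Rightarrow> 'm" ("ID\<index>")

abbreviation mor :: "('o, 'm) precat \<Rightarrow> 'o \<Rightarrow> 'o \<Rightarrow> 'm set"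
  where "mor \<C> X Y \<equiv> carrier (Hom\<^bsub>\<C>\<^esub> X Y)"

abbreviation mzero :: "('o, 'm) precat \<Rightarrow> 'o \<Rightarrow> 'o \<Rightarrow> 'm"
  where "mzero \<C> X Y \<equiv> \<one>\<^bsub>Hom\<^bsub>\<C>\<^esub> X Y\<^esub>"

abbreviation madd :: "('o, 'm) precat \<Rightarrow> 'o \<Rightarrow> 'o \<Rightarrow> 'm \<Rightarrow> 'm \<Rightarrow> 'm"
  where "madd \<C> X Y f g \<equiv> f \<otimes>\<^bsub>Hom\<^bsub>\<C>\<^esub> X Y\<^esub> g"

abbreviation mneg :: "('o, 'm) precat \<Rightarrow> 'o \<Rightarrow> 'o \<Rightarrow> 'm \<Rightarrow> 'm"
  where "mneg \<C> X Y f \<equiv> inv\<^bsub>Hom\<^bsub>\<C>\<^esub> X Y\<^esub> f"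

locale preadditive_category =
  fixes \<C> :: "('o, 'm) precat" (structure)
  assumes hom_comm_group: "\<lbrakk>X \<in> Ob; Y \<in> Ob\<rbrakk> \<Longrightarrow> comm_group (Hom X Y)"
    and comp_closed: "\<lbrakk>X \<in> Ob; Y \<in> Ob; Z \<in> Ob; f \<in> mor \<C> X Y; g \<in> mor \<C> Y Z\<rbrakk>
          \<Longrightarrow> g \<cdot> f \<in> mor \<C> X Z"
    and comp_assoc: "\<lbrakk>W \<in> Ob; X \<in> Ob; Y \<in> Ob; Z \<in> Ob;
          f \<in> mor \<C> W X; g \<in> mor \<C> X Y; h \<in> mor \<C> Y Z\<rbrakk> \<Longrightarrow> h \<cdot> (g \<cdot> f) = (h \<cdot> g) \<cdot> f"
    and ident_closed: "X \<in> Ob \<Longrightarrow> ID X \<in> mor \<C> X X"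
    and comp_ident_right: "\<lbrakk>X \<in> Ob; Y \<in> Ob; f \<in> mor \<C> X Y\<rbrakk> \<Longrightarrow> f \<cdot> ID X = f"
    and comp_ident_left: "\<lbrakk>X \<in> Ob; Y \<in> Ob; f \<in> mor \<C> X Y\<rbrakk> \<Longrightarrow> ID Y \<cdot> f = f"
    and comp_add_right: "\<lbrakk>X \<in> Ob; Y \<in> Ob; Z \<in> Ob; f \<in> mor \<C> X Y; f' \<in> mor \<C> X Y; g \<in> mor \<C> Y Z\<rbrakk>
          \<Longrightarrow> g \<cdot> madd \<C> X Y f f' = madd \<C> X Z (g \<cdot> f) (g \<cdot> f')"
    and comp_add_left: "\<lbrakk>X \<in> Ob; Y \<in> Ob; Z \<in> Ob; f \<in> mor \<C> X Y; g \<in> mor \<C> Y Z; g' \<in> mor \<C> Y Z\<rbrakk>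
          \<Longrightarrow> madd \<C> Y Z g g' \<cdot> f = madd \<C> X Z (g \<cdot> f) (g' \<cdot> f)"

context
  fixes \<C> :: "('o, 'm) precat" (structure)
begin

definition zero_object :: "'o \<Rightarrow> bool"
  where "zero_object Z \<longleftrightarrow> Z \<in> Ob \<and>
    (\<forall>X\<in>Ob. (\<exists>!f. f \<in> mor \<C> Z X) \<and> (\<exists>!f. f \<in> mor \<C> X Z))"

definition biproduct :: "'o \<Rightarrow> 'o \<Rightarrow> 'o \<Rightarrow> 'm \<Rightarrow> 'm \<Rightarrow> 'm \<Rightarrow> 'm \<Rightarrow> bool"
  where "biproduct X Y S i j p q \<longleftrightarrow>
    S \<in> Ob \<and> i \<in> mor \<C> X S \<and> j \<in> mor \<C> Y S \<and> p \<in> mor \<C> S X \<and> q \<in> mor \<C> S Y \<and>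
    p \<cdot> i = ID X \<and> q \<cdot> j = ID Y \<and> p \<cdot> j = mzero \<C> Y X \<and> q \<cdot> i = mzero \<C> X Y \<and>
    madd \<C> S S (i \<cdot> p) (j \<cdot> q) = ID S"

definition is_kernel :: "'o \<Rightarrow> 'o \<Rightarrow> 'm \<Rightarrow> 'o \<Rightarrow> 'm \<Rightarrow> bool"
  where "is_kernel X Y f K k \<longleftrightarrow>
    K \<in> Ob \<and> k \<in> mor \<C> K X \<and> f \<cdot> k = mzero \<C> K Y \<and>
    (\<forall>T\<in>Ob. \<forall>t\<in>mor \<C> T X. f \<cdot> t = mzero \<C> T Y \<longrightarrow> (\<exists>!u. u \<in> mor \<C> T K \<and> k \<cdot> u = t))"

definition retraction :: "'o \<Rightarrow> 'o \<Rightarrow> 'm \<Rightarrow> bool"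
  where "retraction X Y r \<longleftrightarrow> r \<in> mor \<C> X Y \<and> (\<exists>s\<in>mor \<C> Y X. r \<cdot> s = ID Y)"

definition weakly_idempotent_complete :: bool
  where "weakly_idempotent_complete \<longleftrightarrow>
    (\<forall>X\<in>Ob. \<forall>Y\<in>Ob. \<forall>r. retraction X Y r \<longrightarrow> (\<exists>K k. is_kernel X Y r K k))"

end

locale additive_category = preadditive_category +
  assumes ex_zero_object: "\<exists>Z. zero_object \<C> Z"
    and ex_biproduct: "\<lbrakk>X \<in> Ob; Y \<in> Ob\<rbrakk> \<Longrightarrow> \<exists>S i j p q. biproduct \<C> X Y S i j p q"

text \<open>
  We fix a zero object and, for each pair of objects, a biproduct diagram. Everything below depends
  on these choices only up to isomorphism.
\<close>

context
  fixes \<C> :: "('o, 'm) precat" (structure)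
begin

definition zob :: 'o
  where "zob = (SOME Z. zero_object \<C> Z)"

definition chosen_biproduct :: "'o \<Rightarrow> 'o \<Rightarrow> 'o \<times> 'm \<times> 'm \<times> 'm \<times> 'm"
  where "chosen_biproduct X Y = (SOME (S, i, j, p, q). biproduct \<C> X Y S i j p q)"

definition dsum :: "'o \<Rightarrow> 'o \<Rightarrow> 'o"
  where "dsum X Y = (case chosen_biproduct X Y of (S, i, j, p, q) \<Rightarrow> S)"

definition inj1 :: "'o \<Rightarrow> 'o \<Rightarrow> 'm"
  where "inj1 X Y = (case chosen_biproduct X Y of (S, i, j, p, q) \<Rightarrow> i)"

definition inj2 :: "'o \<Rightarrow> 'o \<Rightarrow> 'm"
  where "inj2 X Y = (case chosen_biproduct X Y of (S, i, j, p, q) \<Rightarrow> j)"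

definition proj1 :: "'o \<Rightarrow> 'o \<Rightarrow> 'm"
  where "proj1 X Y = (case chosen_biproduct X Y of (S, i, j, p, q) \<Rightarrow> p)"

definition proj2 :: "'o \<Rightarrow> 'o \<Rightarrow> 'm"
  where "proj2 X Y = (case chosen_biproduct X Y of (S, i, j, p, q) \<Rightarrow> q)"

text \<open>
  \<open>col T X Y a b\<close> is the column with entries \<open>a : T \<rightarrow> X\<close> and \<open>b : T \<rightarrow> Y\<close>, and
  \<open>row X Y T a b\<close> the row with entries \<open>a : X \<rightarrow> T\<close> and \<open>b : Y \<rightarrow> T\<close>. In \<open>mat22 X Y X' Y' a b c d\<close>
  from \<open>X \<oplus> Y\<close> to \<open>X' \<oplus> Y'\<close>, the first row is \<open>a, b\<close> and the second row is \<open>c, d\<close>.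
\<close>

definition col :: "'o \<Rightarrow> 'o \<Rightarrow> 'o \<Rightarrow> 'm \<Rightarrow> 'm \<Rightarrow> 'm"
  where "col T X Y a b = madd \<C> T (dsum X Y) (inj1 X Y \<cdot> a) (inj2 X Y \<cdot> b)"

definition row :: "'o \<Rightarrow> 'o \<Rightarrow> 'o \<Rightarrow> 'm \<Rightarrow> 'm \<Rightarrow> 'm"
  where "row X Y T a b = madd \<C> (dsum X Y) T (a \<cdot> proj1 X Y) (b \<cdot> proj2 X Y)"

definition mat22 :: "'o \<Rightarrow> 'o \<Rightarrow> 'o \<Rightarrow> 'o \<Rightarrow> 'm \<Rightarrow> 'm \<Rightarrow> 'm \<Rightarrow> 'm \<Rightarrow> 'm"
  where "mat22 X Y X' Y' a b c d = col (dsum X Y) X' Y' (row X Y X' a b) (row X Y Y' c d)"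

end


section \<open>Complexes\<close>

text \<open>
  A complex concentrated in degrees \<open>0, \<dots>, n + 1\<close> is given by its terms \<open>cob X i\<close> for
  \<open>i \<le> n + 1\<close> and its differentials \<open>cdf X i : cob X i \<rightarrow> cob X (i + 1)\<close> for \<open>i \<le> n\<close>.
  Values at larger indices are irrelevant: no definition below inspects them, and
  a homotopy class contains all the complexes that differ from a member only there.
\<close>

record ('o, 'm) cpx =
  cob :: "nat \<Rightarrow> 'o"
  cdf :: "nat \<Rightarrow> 'm"

context
  fixes n :: nat and \<C> :: "('o, 'm) precat" (structure)
begin

definition is_complex :: "('o, 'm) cpx \<Rightarrow> bool"
  where "is_complex X \<longleftrightarrow>
    (\<forall>i\<le>n+1. cob X i \<in> Ob) \<and>
    (\<forall>i\<le>n. cdf X i \<in> mor \<C> (cob X i) (cob X (i+1))) \<and>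
    (\<forall>i<n. cdf X (i+1) \<cdot> cdf X i = mzero \<C> (cob X i) (cob X (i+2)))"

definition chain_map :: "('o, 'm) cpx \<Rightarrow> ('o, 'm) cpx \<Rightarrow> (nat \<Rightarrow> 'm) \<Rightarrow> bool"
  where "chain_map X Y f \<longleftrightarrow>
    (\<forall>i\<le>n+1. f i \<in> mor \<C> (cob X i) (cob Y i)) \<and>
    (\<forall>i\<le>n. f (i+1) \<cdot> cdf X i = cdf Y i \<cdot> f i)"

text \<open>In a null-homotopy \<open>h\<close>, the component \<open>h i\<close> goes from degree \<open>i + 1\<close> to degree \<open>i\<close>.\<close>

definition null_homotopic :: "('o, 'm) cpx \<Rightarrow> ('o, 'm) cpx \<Rightarrow> (nat \<Rightarrow> 'm) \<Rightarrow> bool"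
  where "null_homotopic X Y u \<longleftrightarrow>
    (\<exists>h. (\<forall>i\<le>n. h i \<in> mor \<C> (cob X (i+1)) (cob Y i)) \<and>
         u 0 = h 0 \<cdot> cdf X 0 \<and>
         (\<forall>i<n. u (i+1) = madd \<C> (cob X (i+1)) (cob Y (i+1))
                            (cdf Y i \<cdot> h i) (h (i+1) \<cdot> cdf X (i+1))) \<and>
         u (n+1) = cdf Y n \<cdot> h n)"

definition homotopic :: "('o, 'm) cpx \<Rightarrow> ('o, 'm) cpx \<Rightarrow> (nat \<Rightarrow> 'm) \<Rightarrow> (nat \<Rightarrow> 'm) \<Rightarrow> bool"
  where "homotopic X Y f g \<longleftrightarrow>
    null_homotopic X Y
      (\<lambda>i. madd \<C> (cob X i) (cob Y i) (f i) (mneg \<C> (cob X i) (cob Y i) (g i)))"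

text \<open>The objects and morphisms of the category of complexes with fixed end terms \<open>A\<close> and \<open>C\<close>.\<close>

definition complex_between :: "'o \<Rightarrow> 'o \<Rightarrow> ('o, 'm) cpx \<Rightarrow> bool"
  where "complex_between A C X \<longleftrightarrow> is_complex X \<and> cob X 0 = A \<and> cob X (n+1) = C"

definition chain_map_between ::
    "'o \<Rightarrow> 'o \<Rightarrow> ('o, 'm) cpx \<Rightarrow> ('o, 'm) cpx \<Rightarrow> (nat \<Rightarrow> 'm) \<Rightarrow> bool"
  where "chain_map_between A C X Y f \<longleftrightarrow> chain_map X Y f \<and> f 0 = ID A \<and> f (n+1) = ID C"

definition homotopy_equivalent :: "'o \<Rightarrow> 'o \<Rightarrow> ('o, 'm) cpx \<Rightarrow> ('o, 'm) cpx \<Rightarrow> bool"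
  where "homotopy_equivalent A C X Y \<longleftrightarrow>
    (\<exists>f g. chain_map_between A C X Y f \<and> chain_map_between A C Y X g \<and>
       homotopic X X (\<lambda>i. g i \<cdot> f i) (\<lambda>i. ID (cob X i)) \<and>
       homotopic Y Y (\<lambda>i. f i \<cdot> g i) (\<lambda>i. ID (cob Y i)))"

definition hclass :: "('o, 'm) cpx \<Rightarrow> ('o, 'm) cpx set"
  where "hclass X = {Y. complex_between (cob X 0) (cob X (n+1)) Y \<and>
                        homotopy_equivalent (cob X 0) (cob X (n+1)) X Y}"

definition triv :: "nat \<Rightarrow> 'o \<Rightarrow> ('o, 'm) cpx"
  where "triv i X =
    (let ob = (\<lambda>j. if j = i \<or> j = i + 1 then X else zob \<C>)
     in \<lparr>cob = ob, cdf = (\<lambda>j. if j = i then ID X else mzero \<C> (ob j) (ob (j+1)))\<rparr>)"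

text \<open>The mapping cones of a chain map \<open>f\<close> from \<open>X\<close> to \<open>Y\<close>, for \<open>n \<ge> 1\<close>.\<close>

definition coneM :: "('o, 'm) cpx \<Rightarrow> ('o, 'm) cpx \<Rightarrow> (nat \<Rightarrow> 'm) \<Rightarrow> ('o, 'm) cpx"
  where "coneM X Y f =
    \<lparr>cob = (\<lambda>i. if i = 0 then cob X 1
                else if i \<le> n then dsum \<C> (cob X (i+1)) (cob Y i)
                else cob Y (n+1)),
     cdf = (\<lambda>i. if i = 0 then
                  col \<C> (cob X 1) (cob X 2) (cob Y 1)
                    (mneg \<C> (cob X 1) (cob X 2) (cdf X 1)) (f 1)
                else if i < n then
                  mat22 \<C> (cob X (i+1)) (cob Y i) (cob X (i+2)) (cob Y (i+1))
                    (mneg \<C> (cob X (i+1)) (cob X (i+2)) (cdf X (i+1)))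
                    (mzero \<C> (cob Y i) (cob X (i+2)))
                    (f (i+1))
                    (cdf Y i)
                else
                  row \<C> (cob X (n+1)) (cob Y n) (cob Y (n+1)) (f (n+1)) (cdf Y n))\<rparr>"

definition coneN :: "('o, 'm) cpx \<Rightarrow> ('o, 'm) cpx \<Rightarrow> (nat \<Rightarrow> 'm) \<Rightarrow> ('o, 'm) cpx"
  where "coneN X Y f =
    \<lparr>cob = (\<lambda>i. if i = 0 then cob X 0
                else if i \<le> n then dsum \<C> (cob X i) (cob Y (i-1))
                else cob Y n),
     cdf = (\<lambda>i. if i = 0 then
                  col \<C> (cob X 0) (cob X 1) (cob Y 0) (cdf X 0) (f 0)
                else if i < n then
                  mat22 \<C> (cob X i) (cob Y (i-1)) (cob X (i+1)) (cob Y i)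
                    (cdf X i)
                    (mzero \<C> (cob Y (i-1)) (cob X (i+1)))
                    (f i)
                    (mneg \<C> (cob Y (i-1)) (cob Y i) (cdf Y (i-1)))
                else
                  row \<C> (cob X n) (cob Y (n-1)) (cob Y n)
                    (f n) (mneg \<C> (cob Y (n-1)) (cob Y n) (cdf Y (n-1))))\<rparr>"

end


section \<open>Extensions and \<open>n\<close>-exangles\<close>

text \<open>
  A functor of two variables, contravariant in the first: \<open>ext G C A\<close> is the group \<open>G(C, A)\<close>, and
  for \<open>c : D \<rightarrow> C\<close> and \<open>a : A \<rightarrow> B\<close> the map \<open>ext_map G c a\<close> goes from \<open>G(C, A)\<close> to \<open>G(D, B)\<close>.
\<close>

record ('o, 'm, 'e) bifun =
  ext :: "'o \<Rightarrow> 'o \<Rightarrow> 'e monoid"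
  ext_map :: "'m \<Rightarrow> 'm \<Rightarrow> 'e \<Rightarrow> 'e"

locale biadditive_functor = additive_category \<C>
  for \<C> :: "('o, 'm) precat" (structure) +
  fixes G :: "('o, 'm, 'e) bifun"
  assumes ext_comm_group: "\<lbrakk>C \<in> Ob; A \<in> Ob\<rbrakk> \<Longrightarrow> comm_group (ext G C A)"
    and ext_map_hom: "\<lbrakk>A \<in> Ob; B \<in> Ob; C \<in> Ob; D \<in> Ob; a \<in> mor \<C> A B; c \<in> mor \<C> D C\<rbrakk>
          \<Longrightarrow> ext_map G c a \<in> hom (ext G C A) (ext G D B)"
    and ext_map_ident: "\<lbrakk>C \<in> Ob; A \<in> Ob; \<delta> \<in> carrier (ext G C A)\<rbrakk>
          \<Longrightarrow> ext_map G (ID C) (ID A) \<delta> = \<delta>"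
    and ext_map_comp: "\<lbrakk>A \<in> Ob; A' \<in> Ob; A'' \<in> Ob; C \<in> Ob; C' \<in> Ob; C'' \<in> Ob;
          a \<in> mor \<C> A A'; a' \<in> mor \<C> A' A''; c \<in> mor \<C> C' C; c' \<in> mor \<C> C'' C';
          \<delta> \<in> carrier (ext G C A)\<rbrakk>
          \<Longrightarrow> ext_map G (c \<cdot> c') (a' \<cdot> a) \<delta> = ext_map G c' a' (ext_map G c a \<delta>)"
    and ext_map_add_left: "\<lbrakk>A \<in> Ob; B \<in> Ob; C \<in> Ob; D \<in> Ob;
          a \<in> mor \<C> A B; c \<in> mor \<C> D C; c' \<in> mor \<C> D C; \<delta> \<in> carrier (ext G C A)\<rbrakk>
          \<Longrightarrow> ext_map G (madd \<C> D C c c') a \<delta> = ext_map G c a \<delta> \<otimes>\<^bsub>ext G D B\<^esub> ext_map G c' a \<delta>"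
    and ext_map_add_right: "\<lbrakk>A \<in> Ob; B \<in> Ob; C \<in> Ob; D \<in> Ob;
          a \<in> mor \<C> A B; a' \<in> mor \<C> A B; c \<in> mor \<C> D C; \<delta> \<in> carrier (ext G C A)\<rbrakk>
          \<Longrightarrow> ext_map G c (madd \<C> A B a a') \<delta> = ext_map G c a \<delta> \<otimes>\<^bsub>ext G D B\<^esub> ext_map G c a' \<delta>"

context
  fixes n :: nat and \<C> :: "('o, 'm) precat" (structure) and G :: "('o, 'm, 'e) bifun"
begin

text \<open>For \<open>\<delta> \<in> G(C, A)\<close>, \<open>push C a \<delta>\<close> is \<open>a\<^sub>*\<delta>\<close> and \<open>pull A c \<delta>\<close> is \<open>c\<^sup>*\<delta>\<close>.\<close>

definition push :: "'o \<Rightarrow> 'm \<Rightarrow> 'e \<Rightarrow> 'e"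
  where "push C a \<delta> = ext_map G (ID C) a \<delta>"

definition pull :: "'o \<Rightarrow> 'm \<Rightarrow> 'e \<Rightarrow> 'e"
  where "pull A c \<delta> = ext_map G c (ID A) \<delta>"

definition ext_morphism :: "'o \<Rightarrow> 'o \<Rightarrow> 'e \<Rightarrow> 'o \<Rightarrow> 'o \<Rightarrow> 'e \<Rightarrow> 'm \<Rightarrow> 'm \<Rightarrow> bool"
  where "ext_morphism C A \<delta> D B \<rho> a c \<longleftrightarrow>
    a \<in> mor \<C> A B \<and> c \<in> mor \<C> C D \<and> push C a \<delta> = pull B c \<rho>"

definition exangle :: "('o, 'm) cpx \<Rightarrow> 'e \<Rightarrow> bool"
  where "exangle X \<delta> \<longleftrightarrow>
    is_complex n \<C> X \<and> \<delta> \<in> carrier (ext G (cob X (n+1)) (cob X 0)) \<and>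
    push (cob X (n+1)) (cdf X 0) \<delta> = \<one>\<^bsub>ext G (cob X (n+1)) (cob X 1)\<^esub> \<and>
    pull (cob X 0) (cdf X n) \<delta> = \<one>\<^bsub>ext G (cob X n) (cob X 0)\<^esub> \<and>
    (\<forall>T\<in>Ob.
       (\<forall>i\<in>{1..n}. kernel (Hom T (cob X i)) (Hom T (cob X (i+1))) (\<lambda>f. cdf X i \<cdot> f)
                    = (\<lambda>f. cdf X (i-1) \<cdot> f) ` mor \<C> T (cob X (i-1))) \<and>
       kernel (Hom T (cob X (n+1))) (ext G T (cob X 0)) (\<lambda>f. pull (cob X 0) f \<delta>)
         = (\<lambda>f. cdf X n \<cdot> f) ` mor \<C> T (cob X n)) \<and>
    (\<forall>T\<in>Ob.
       (\<forall>i\<in>{1..n}. kernel (Hom (cob X i) T) (Hom (cob X (i-1)) T) (\<lambda>g. g \<cdot> cdf X (i-1))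
                    = (\<lambda>g. g \<cdot> cdf X i) ` mor \<C> (cob X (i+1)) T) \<and>
       kernel (Hom (cob X 0) T) (ext G (cob X (n+1)) T) (\<lambda>g. push (cob X (n+1)) g \<delta>)
         = (\<lambda>g. g \<cdot> cdf X 0) ` mor \<C> (cob X 1) T)"

end


section \<open>Realisations and \<open>n\<close>-exangulated categories\<close>

text \<open>A realisation \<open>r\<close> maps \<open>\<delta> \<in> G(C, A)\<close> to the homotopy class \<open>r C A \<delta>\<close>.\<close>

type_synonym ('o, 'm, 'e) realisation = "'o \<Rightarrow> 'o \<Rightarrow> 'e \<Rightarrow> ('o, 'm) cpx set"

context
  fixes n :: nat and \<C> :: "('o, 'm) precat" (structure)
    and G :: "('o, 'm, 'e) bifun" and r :: "('o, 'm, 'e) realisation"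
begin

definition distinguished :: "('o, 'm) cpx \<Rightarrow> 'e \<Rightarrow> bool"
  where "distinguished X \<delta> \<longleftrightarrow>
    is_complex n \<C> X \<and> \<delta> \<in> carrier (ext G (cob X (n+1)) (cob X 0)) \<and>
    r (cob X (n+1)) (cob X 0) \<delta> = hclass n \<C> X"

definition conflation :: "('o, 'm) cpx \<Rightarrow> bool"
  where "conflation X \<longleftrightarrow> (\<exists>\<delta>. distinguished X \<delta>)"

definition inflation :: "'o \<Rightarrow> 'o \<Rightarrow> 'm \<Rightarrow> bool"
  where "inflation A B f \<longleftrightarrow>
    (\<exists>X. conflation X \<and> cob X 0 = A \<and> cob X 1 = B \<and> cdf X 0 = f)"

definition deflation :: "'o \<Rightarrow> 'o \<Rightarrow> 'm \<Rightarrow> bool"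
  where "deflation B C f \<longleftrightarrow>
    (\<exists>X. conflation X \<and> cob X n = B \<and> cob X (n+1) = C \<and> cdf X n = f)"

end

locale exact_realisation = biadditive_functor \<C> G
  for n :: nat and \<C> :: "('o, 'm) precat" (structure) and G :: "('o, 'm, 'e) bifun" +
  fixes r :: "('o, 'm, 'e) realisation"
  assumes realises: "\<lbrakk>C \<in> Ob; A \<in> Ob; \<delta> \<in> carrier (ext G C A)\<rbrakk>
          \<Longrightarrow> \<exists>X. complex_between n \<C> A C X \<and> r C A \<delta> = hclass n \<C> X"
    and R0: "\<lbrakk>distinguished n \<C> G r X \<delta>; distinguished n \<C> G r Y \<rho>;
          ext_morphism \<C> G (cob X (n+1)) (cob X 0) \<delta> (cob Y (n+1)) (cob Y 0) \<rho> a c\<rbrakk>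
          \<Longrightarrow> \<exists>f. chain_map n \<C> X Y f \<and> f 0 = a \<and> f (n+1) = c"
    and R1: "distinguished n \<C> G r X \<delta> \<Longrightarrow> exangle n \<C> G X \<delta>"
    and R2_left: "A \<in> Ob \<Longrightarrow> r (zob \<C>) A \<one>\<^bsub>ext G (zob \<C>) A\<^esub> = hclass n \<C> (triv \<C> 0 A)"
    and R2_right: "C \<in> Ob \<Longrightarrow> r C (zob \<C>) \<one>\<^bsub>ext G C (zob \<C>)\<^esub> = hclass n \<C> (triv \<C> n C)"

locale n_exangulated_category = exact_realisation n \<C> G r
  for n :: nat and \<C> :: "('o, 'm) precat" (structure)
    and G :: "('o, 'm, 'e) bifun" and r :: "('o, 'm, 'e) realisation" +
  assumes EA1: "\<lbrakk>inflation n \<C> G r A B f; inflation n \<C> G r B C g\<rbrakk>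
          \<Longrightarrow> inflation n \<C> G r A C (g \<cdot> f)"
    and EA1_op: "\<lbrakk>deflation n \<C> G r A B f; deflation n \<C> G r B C g\<rbrakk>
          \<Longrightarrow> deflation n \<C> G r A C (g \<cdot> f)"
    and EA2: "\<lbrakk>c \<in> mor \<C> (cob X (n+1)) (cob Y (n+1)); cob X 0 = A; cob Y 0 = A;
          distinguished n \<C> G r X (pull \<C> G A c \<rho>); distinguished n \<C> G r Y \<rho>\<rbrakk>
          \<Longrightarrow> \<exists>f. chain_map n \<C> X Y f \<and> f 0 = ID A \<and> f (n+1) = c \<and>
                distinguished n \<C> G r (coneM n \<C> X Y f) (push \<C> G (cob Y (n+1)) (cdf X 0) \<rho>)"
    and EA2_op: "\<lbrakk>a \<in> mor \<C> (cob X 0) (cob Y 0); cob X (n+1) = C; cob Y (n+1) = C;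
          distinguished n \<C> G r X \<delta>; distinguished n \<C> G r Y (push \<C> G C a \<delta>)\<rbrakk>
          \<Longrightarrow> \<exists>f. chain_map n \<C> X Y f \<and> f 0 = a \<and> f (n+1) = ID C \<and>
                distinguished n \<C> G r (coneN n \<C> X Y f) (pull \<C> G (cob X 0) (cdf Y n) \<delta>)"

end

theory Submission
  imports Defs
begin

text \<open>
  Let \<open>gf\<close> be an inflation and \<open>W\<close> a conflation with first differential \<open>gf\<close>. The cone that (EA2op)
  provides for pushing \<open>W\<close> out along \<open>f\<close> is a conflation \<open>N\<close> whose first differential is the column
  \<open>X \<rightarrow> Z \<oplus> Y\<close> with entries \<open>gf\<close> and \<open>f\<close>. A shear of \<open>Z \<oplus> Y\<close> by \<open>g\<close> turns this column into \<open>(0, f)\<close>. Hence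
  \<open>Z\<close> is a superfluous summand of \<open>N\<^sub>1\<close>: the projection \<open>p\<close> of the sheared biproduct onto \<open>Z\<close> kills
  \<open>d\<^sub>0\<close>, so it extends along \<open>d\<^sub>1\<close> to some \<open>u : N\<^sub>2 \<rightarrow> Z\<close>, and \<open>s = d\<^sub>1 i\<close> satisfies \<open>u s = 1\<close>, where \<open>i\<close>
  is the inclusion of \<open>Z\<close>.

  It remains to cancel \<open>Z\<close> from degrees 1 and 2. If \<open>n = 1\<close>, this asks for a complement
  of \<open>Z\<close> in \<open>N\<^sub>2\<close>, which is the kernel of the retraction \<open>u\<close> and exists by weak idempotent
  completeness. If \<open>n \<ge> 2\<close>, no idempotent has to be split: instead of removing \<open>Z\<close> from \<open>N\<^sub>2\<close>, one adds a
  copy of \<open>Z\<close> to \<open>N\<^sub>3\<close> and sends \<open>N\<^sub>2\<close> to it by \<open>u\<close>. In both cases the result is a complex \<open>Q\<close> with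
  first differential \<open>f\<close>, which is a homotopy retract of \<open>N\<close> by maps that are the identity in
  degree 0.

  The proof is carried by the lemma \<open>distinguished_homotopy_retract\<close>: such a retract is again
  a conflation. The last term of \<open>Q\<close> may differ from that of \<open>N\<close> (it does for \<open>n \<le> 2\<close>), so \<open>Q\<close> need
  not be homotopy equivalent to \<open>N\<close> with fixed ends. It is compared with a conflation \<open>B\<close> which
  realises the pulled back extension; (R0) gives maps between \<open>B\<close> and \<open>N\<close>, hence between \<open>B\<close> and
  \<open>Q\<close>, and a null-homotopic correction makes them the identity at both ends. Finally, two
  complexes with the same end terms which are exact under the functors \<open>Hom(_, T)\<close> and which map
  to each other with identities at the ends are homotopy equivalent (\<open>homotopy_equivalentI\<close>).
  The point is that an endomorphism \<open>t\<close> of such a complex which vanishes at both ends need not be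
  null-homotopic, but its square is, so \<open>1 + t\<close> has the homotopy inverse \<open>1 - t\<close>.
\<close>

section \<open>Arithmetic in hom-groups\<close>

context preadditive_category
begin

lemma hom_add:
  assumes "X \<in> Ob" "Y \<in> Ob"
  shows hom_zero_closed: "mzero \<C> X Y \<in> mor \<C> X Y"
    and hom_add_closed: "\<lbrakk>f \<in> mor \<C> X Y; g \<in> mor \<C> X Y\<rbrakk> \<Longrightarrow> madd \<C> X Y f g \<in> mor \<C> X Y"
    and hom_neg_closed: "f \<in> mor \<C> X Y \<Longrightarrow> mneg \<C> X Y f \<in> mor \<C> X Y"
    and hom_zero_add: "f \<in> mor \<C> X Y \<Longrightarrow> madd \<C> X Y (mzero \<C> X Y) f = f"
    and hom_add_zero: "f \<in> mor \<C> X Y \<Longrightarrow> madd \<C> X Y f (mzero \<C> X Y) = f"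
    and hom_add_neg: "f \<in> mor \<C> X Y \<Longrightarrow> madd \<C> X Y f (mneg \<C> X Y f) = mzero \<C> X Y"
    and hom_neg_add: "f \<in> mor \<C> X Y \<Longrightarrow> madd \<C> X Y (mneg \<C> X Y f) f = mzero \<C> X Y"
    and hom_add_comm: "\<lbrakk>f \<in> mor \<C> X Y; g \<in> mor \<C> X Y\<rbrakk> \<Longrightarrow> madd \<C> X Y f g = madd \<C> X Y g f"
    and hom_add_assoc: "\<lbrakk>f \<in> mor \<C> X Y; g \<in> mor \<C> X Y; h \<in> mor \<C> X Y\<rbrakk>
          \<Longrightarrow> madd \<C> X Y (madd \<C> X Y f g) h = madd \<C> X Y f (madd \<C> X Y g h)"
    and hom_add_left_comm: "\<lbrakk>f \<in> mor \<C> X Y; g \<in> mor \<C> X Y; h \<in> mor \<C> X Y\<rbrakk>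
          \<Longrightarrow> madd \<C> X Y f (madd \<C> X Y g h) = madd \<C> X Y g (madd \<C> X Y f h)"
    and hom_add_left_cancel: "\<lbrakk>f \<in> mor \<C> X Y; g \<in> mor \<C> X Y; h \<in> mor \<C> X Y\<rbrakk>
          \<Longrightarrow> madd \<C> X Y f g = madd \<C> X Y f h \<longleftrightarrow> g = h"
    and hom_add_neg_cancel: "\<lbrakk>f \<in> mor \<C> X Y; g \<in> mor \<C> X Y\<rbrakk>
          \<Longrightarrow> madd \<C> X Y f (madd \<C> X Y (mneg \<C> X Y f) g) = g"
    and hom_neg_distrib: "\<lbrakk>f \<in> mor \<C> X Y; g \<in> mor \<C> X Y\<rbrakk>
          \<Longrightarrow> mneg \<C> X Y (madd \<C> X Y f g) = madd \<C> X Y (mneg \<C> X Y f) (mneg \<C> X Y g)"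
    and hom_neg_neg: "f \<in> mor \<C> X Y \<Longrightarrow> mneg \<C> X Y (mneg \<C> X Y f) = f"
    and hom_neg_zero: "mneg \<C> X Y (mzero \<C> X Y) = mzero \<C> X Y"
    and hom_diff_eq_iff: "\<lbrakk>f \<in> mor \<C> X Y; g \<in> mor \<C> X Y; h \<in> mor \<C> X Y\<rbrakk>
          \<Longrightarrow> madd \<C> X Y f (mneg \<C> X Y g) = h \<longleftrightarrow> f = madd \<C> X Y g h"
proof -
  interpret comm_group "Hom X Y" using hom_comm_group assms by blast
  show "mzero \<C> X Y \<in> mor \<C> X Y" by simp
  show "madd \<C> X Y f g \<in> mor \<C> X Y" if "f \<in> mor \<C> X Y" "g \<in> mor \<C> X Y" using that by simp
  show "mneg \<C> X Y f \<in> mor \<C> X Y" if "f \<in> mor \<C> X Y" using that by simp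
  show "madd \<C> X Y (mzero \<C> X Y) f = f" if "f \<in> mor \<C> X Y" using that by simp
  show "madd \<C> X Y f (mzero \<C> X Y) = f" if "f \<in> mor \<C> X Y" using that by simp
  show "madd \<C> X Y f (mneg \<C> X Y f) = mzero \<C> X Y" if "f \<in> mor \<C> X Y" using that by simp
  show "madd \<C> X Y (mneg \<C> X Y f) f = mzero \<C> X Y" if "f \<in> mor \<C> X Y" using that by simp
  show "madd \<C> X Y f g = madd \<C> X Y g f" if "f \<in> mor \<C> X Y" "g \<in> mor \<C> X Y"
    using that by (rule m_comm)
  show "madd \<C> X Y (madd \<C> X Y f g) h = madd \<C> X Y f (madd \<C> X Y g h)"
    if "f \<in> mor \<C> X Y" "g \<in> mor \<C> X Y" "h \<in> mor \<C> X Y" using that by (rule m_assoc)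
  show "madd \<C> X Y f (madd \<C> X Y g h) = madd \<C> X Y g (madd \<C> X Y f h)"
    if "f \<in> mor \<C> X Y" "g \<in> mor \<C> X Y" "h \<in> mor \<C> X Y" using that by (rule m_lcomm)
  show "madd \<C> X Y f g = madd \<C> X Y f h \<longleftrightarrow> g = h"
    if "f \<in> mor \<C> X Y" "g \<in> mor \<C> X Y" "h \<in> mor \<C> X Y" using that by simp
  show "madd \<C> X Y f (madd \<C> X Y (mneg \<C> X Y f) g) = g"
    if "f \<in> mor \<C> X Y" "g \<in> mor \<C> X Y" using that by (simp add: m_assoc[symmetric])
  show "mneg \<C> X Y (madd \<C> X Y f g) = madd \<C> X Y (mneg \<C> X Y f) (mneg \<C> X Y g)"
    if "f \<in> mor \<C> X Y" "g \<in> mor \<C> X Y" using that by (rule inv_mult)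
  show "mneg \<C> X Y (mneg \<C> X Y f) = f" if "f \<in> mor \<C> X Y" using that by simp
  show "mneg \<C> X Y (mzero \<C> X Y) = mzero \<C> X Y" by simp
  show "madd \<C> X Y f (mneg \<C> X Y g) = h \<longleftrightarrow> f = madd \<C> X Y g h"
    if "f \<in> mor \<C> X Y" "g \<in> mor \<C> X Y" "h \<in> mor \<C> X Y"
    using that by (metis inv_closed inv_solve_right m_comm)
qed

text \<open>
  Composition annotated with its three objects. In \<open>g \<cdot> f\<close> the middle object is not visible, so
  conditional rewriting could not find the typing conditions of the bilinearity and associativity
  laws; with the annotation the laws form a terminating system of rewrite rules.
\<close>

definition cmp :: "'o \<Rightarrow> 'o \<Rightarrow> 'o \<Rightarrow> 'm \<Rightarrow> 'm \<Rightarrow> 'm"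
  where "cmp X Y Z g f = g \<cdot> f"

lemma cmp_closed: "\<lbrakk>X \<in> Ob; Y \<in> Ob; Z \<in> Ob; f \<in> mor \<C> X Y; g \<in> mor \<C> Y Z\<rbrakk>
    \<Longrightarrow> cmp X Y Z g f \<in> mor \<C> X Z"
  unfolding cmp_def by (rule comp_closed)

lemma cmp_assoc: "\<lbrakk>W \<in> Ob; X \<in> Ob; Y \<in> Ob; Z \<in> Ob; f \<in> mor \<C> W X; g \<in> mor \<C> X Y; h \<in> mor \<C> Y Z\<rbrakk>
    \<Longrightarrow> cmp W X Z (cmp X Y Z h g) f = cmp W Y Z h (cmp W X Y g f)"
  unfolding cmp_def using comp_assoc by metis

lemma cmp_ident:
  "\<lbrakk>X \<in> Ob; Y \<in> Ob; f \<in> mor \<C> X Y\<rbrakk> \<Longrightarrow> cmp X X Y f (ID X) = f"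
  "\<lbrakk>X \<in> Ob; Y \<in> Ob; f \<in> mor \<C> X Y\<rbrakk> \<Longrightarrow> cmp X Y Y (ID Y) f = f"
  unfolding cmp_def using comp_ident_left comp_ident_right by auto

lemma cmp_add:
  "\<lbrakk>X \<in> Ob; Y \<in> Ob; Z \<in> Ob; f \<in> mor \<C> X Y; f' \<in> mor \<C> X Y; g \<in> mor \<C> Y Z\<rbrakk>
     \<Longrightarrow> cmp X Y Z g (madd \<C> X Y f f') = madd \<C> X Z (cmp X Y Z g f) (cmp X Y Z g f')"
  "\<lbrakk>X \<in> Ob; Y \<in> Ob; Z \<in> Ob; f \<in> mor \<C> X Y; g \<in> mor \<C> Y Z; g' \<in> mor \<C> Y Z\<rbrakk>
     \<Longrightarrow> cmp X Y Z (madd \<C> Y Z g g') f = madd \<C> X Z (cmp X Y Z g f) (cmp X Y Z g' f)"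
  unfolding cmp_def using comp_add_left comp_add_right by auto

lemma cmp_zero:
  assumes "X \<in> Ob" "Y \<in> Ob" "Z \<in> Ob"
  shows "g \<in> mor \<C> Y Z \<Longrightarrow> cmp X Y Z g (mzero \<C> X Y) = mzero \<C> X Z"
    and "f \<in> mor \<C> X Y \<Longrightarrow> cmp X Y Z (mzero \<C> Y Z) f = mzero \<C> X Z"
proof -
  show "cmp X Y Z g (mzero \<C> X Y) = mzero \<C> X Z" if "g \<in> mor \<C> Y Z"
    using cmp_add(1)[OF assms hom_zero_closed hom_zero_closed that] assms that
    by (metis cmp_closed hom_add_left_cancel hom_add_zero hom_zero_closed)
  show "cmp X Y Z (mzero \<C> Y Z) f = mzero \<C> X Z" if "f \<in> mor \<C> X Y"
    using cmp_add(2)[OF assms that hom_zero_closed hom_zero_closed] assms that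
    by (metis cmp_closed hom_add_left_cancel hom_add_zero hom_zero_closed)
qed

lemma cmp_neg:
  assumes "X \<in> Ob" "Y \<in> Ob" "Z \<in> Ob" "f \<in> mor \<C> X Y" "g \<in> mor \<C> Y Z"
  shows "cmp X Y Z g (mneg \<C> X Y f) = mneg \<C> X Z (cmp X Y Z g f)"
    and "cmp X Y Z (mneg \<C> Y Z g) f = mneg \<C> X Z (cmp X Y Z g f)"
proof -
  have c: "cmp X Y Z g f \<in> mor \<C> X Z" using assms by (simp add: cmp_closed)
  have 1: "madd \<C> X Z (cmp X Y Z g f) (cmp X Y Z g (mneg \<C> X Y f)) = mzero \<C> X Z"
    using assms by (simp add: cmp_add(1)[symmetric] hom_neg_closed hom_add_neg cmp_zero)
  show "cmp X Y Z g (mneg \<C> X Y f) = mneg \<C> X Z (cmp X Y Z g f)"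
    using assms c 1
    by (metis cmp_closed hom_add_left_cancel hom_neg_closed hom_add_neg)
  have 2: "madd \<C> X Z (cmp X Y Z g f) (cmp X Y Z (mneg \<C> Y Z g) f) = mzero \<C> X Z"
    using assms by (simp add: cmp_add(2)[symmetric] hom_neg_closed hom_add_neg cmp_zero)
  show "cmp X Y Z (mneg \<C> Y Z g) f = mneg \<C> X Z (cmp X Y Z g f)"
    using assms c 2
    by (metis cmp_closed hom_add_left_cancel hom_neg_closed hom_add_neg)
qed

lemmas hom_closed = hom_zero_closed hom_add_closed hom_neg_closed cmp_closed ident_closed
lemmas hom_simps = hom_closed hom_zero_add hom_add_zero hom_add_neg hom_neg_add hom_add_neg_cancel hom_neg_distrib
  hom_neg_neg hom_neg_zero
  cmp_assoc cmp_ident cmp_add cmp_zero cmp_neg hom_add_assoc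

end

section \<open>Complexes, chain maps and homotopies\<close>

lemma is_complexD:
  fixes \<C> :: "('o, 'm) precat" (structure)
  assumes "is_complex n \<C> X"
  shows "i \<le> Suc n \<Longrightarrow> cob X i \<in> Ob"
    and "i \<le> n \<Longrightarrow> cdf X i \<in> mor \<C> (cob X i) (cob X (Suc i))"
    and "i < n \<Longrightarrow> cdf X (Suc i) \<cdot> cdf X i = mzero \<C> (cob X i) (cob X (Suc (Suc i)))"
  using assms by (auto simp: is_complex_def)

lemma chain_mapD:
  fixes \<C> :: "('o, 'm) precat" (structure)
  assumes "chain_map n \<C> X Y f"
  shows "i \<le> Suc n \<Longrightarrow> f i \<in> mor \<C> (cob X i) (cob Y i)"
    and "i \<le> n \<Longrightarrow> f (Suc i) \<cdot> cdf X i = cdf Y i \<cdot> f i"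
  using assms by (auto simp: chain_map_def)

lemma chain_mapI:
  fixes \<C> :: "('o, 'm) precat" (structure)
  assumes "\<And>i. i \<le> Suc n \<Longrightarrow> f i \<in> mor \<C> (cob X i) (cob Y i)"
    and "\<And>i. i \<le> n \<Longrightarrow> f (Suc i) \<cdot> cdf X i = cdf Y i \<cdot> f i"
  shows "chain_map n \<C> X Y f"
  using assms by (auto simp: chain_map_def)

context preadditive_category
begin

lemma is_complex_cmp:
  assumes "is_complex n \<C> X" "i < n"
  shows "cmp (cob X i) (cob X (Suc i)) (cob X (Suc (Suc i))) (cdf X (Suc i)) (cdf X i)
    = mzero \<C> (cob X i) (cob X (Suc (Suc i)))"
  using is_complexD(3)[OF assms] by (simp add: cmp_def)

lemma chain_map_cmp:
  assumes "chain_map n \<C> X Y f" "i \<le> n"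
  shows "cmp (cob X i) (cob X (Suc i)) (cob Y (Suc i)) (f (Suc i)) (cdf X i)
    = cmp (cob X i) (cob Y i) (cob Y (Suc i)) (cdf Y i) (f i)"
  using chain_mapD(2)[OF assms] by (simp add: cmp_def)

text \<open>
  \<open>f = g + (dh + hd)\<close>. Writing the homotopy relation without negatives keeps the computations
  with explicit homotopies short.
\<close>

definition homotopy :: "nat \<Rightarrow> ('o, 'm) cpx \<Rightarrow> ('o, 'm) cpx \<Rightarrow> (nat \<Rightarrow> 'm) \<Rightarrow> (nat \<Rightarrow> 'm)
    \<Rightarrow> (nat \<Rightarrow> 'm) \<Rightarrow> bool"
  where "homotopy n X Y h f g \<longleftrightarrow>
    (\<forall>i\<le>n. h i \<in> mor \<C> (cob X (Suc i)) (cob Y i)) \<and>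
    f 0 = madd \<C> (cob X 0) (cob Y 0) (g 0) (h 0 \<cdot> cdf X 0) \<and>
    (\<forall>i<n. f (Suc i) = madd \<C> (cob X (Suc i)) (cob Y (Suc i)) (g (Suc i))
       (madd \<C> (cob X (Suc i)) (cob Y (Suc i)) (cdf Y i \<cdot> h i) (h (Suc i) \<cdot> cdf X (Suc i)))) \<and>
    f (Suc n) = madd \<C> (cob X (Suc n)) (cob Y (Suc n)) (g (Suc n)) (cdf Y n \<cdot> h n)"

lemma homotopic_iff_homotopy:
  assumes "is_complex n \<C> X" "is_complex n \<C> Y"
    and "\<And>i. i \<le> Suc n \<Longrightarrow> f i \<in> mor \<C> (cob X i) (cob Y i)"
    and "\<And>i. i \<le> Suc n \<Longrightarrow> g i \<in> mor \<C> (cob X i) (cob Y i)"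
  shows "homotopic n \<C> X Y f g \<longleftrightarrow> (\<exists>h. homotopy n X Y h f g)"
proof -
  note [simp] = is_complexD[OF assms(1)] is_complexD[OF assms(2)] assms(3,4) hom_diff_eq_iff
    hom_closed[unfolded cmp_def]
  have c: "h i \<cdot> cdf X i \<in> mor \<C> (cob X i) (cob Y i)"
    if "i \<le> n" "h i \<in> mor \<C> (cob X (Suc i)) (cob Y i)" for h i
    using that comp_closed[of "cob X i" "cob X (Suc i)" "cob Y i"] by simp
  have d: "cdf Y i \<cdot> h i \<in> mor \<C> (cob X (Suc i)) (cob Y (Suc i))"
    if "i \<le> n" "h i \<in> mor \<C> (cob X (Suc i)) (cob Y i)" for h i
    using that comp_closed[of "cob X (Suc i)" "cob Y i" "cob Y (Suc i)"] by simp
  show ?thesis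
    unfolding homotopic_def null_homotopic_def homotopy_def Suc_eq_plus1[symmetric]
    by (intro ex_cong1 conj_cong) (auto simp: c d)
qed

lemma homotopy_sym:
  assumes "is_complex n \<C> X" "is_complex n \<C> Y"
    and "\<And>i. i \<le> Suc n \<Longrightarrow> f i \<in> mor \<C> (cob X i) (cob Y i)"
    and "\<And>i. i \<le> Suc n \<Longrightarrow> g i \<in> mor \<C> (cob X i) (cob Y i)"
    and "homotopy n X Y h f g"
  shows "homotopy n X Y (\<lambda>i. mneg \<C> (cob X (Suc i)) (cob Y i) (h i)) g f"
proof -
  note c [simp] = is_complexD[OF assms(1)] is_complexD[OF assms(2)] assms(3,4)
  have h [simp]: "h i \<in> mor \<C> (cob X (Suc i)) (cob Y i)" if "i \<le> n" for i
    using assms(5) that by (auto simp: homotopy_def)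
  have e: "f 0 = madd \<C> (cob X 0) (cob Y 0) (g 0) (cmp (cob X 0) (cob X (Suc 0)) (cob Y 0) (h 0) (cdf X 0))"
    "\<And>i. i < n \<Longrightarrow> f (Suc i) = madd \<C> (cob X (Suc i)) (cob Y (Suc i)) (g (Suc i))
       (madd \<C> (cob X (Suc i)) (cob Y (Suc i))
         (cmp (cob X (Suc i)) (cob Y i) (cob Y (Suc i)) (cdf Y i) (h i))
         (cmp (cob X (Suc i)) (cob X (Suc (Suc i))) (cob Y (Suc i)) (h (Suc i)) (cdf X (Suc i))))"
    "f (Suc n) = madd \<C> (cob X (Suc n)) (cob Y (Suc n)) (g (Suc n))
       (cmp (cob X (Suc n)) (cob Y n) (cob Y (Suc n)) (cdf Y n) (h n))"
    using assms(5) by (auto simp: homotopy_def cmp_def)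
  have "g 0 = madd \<C> (cob X 0) (cob Y 0) (f 0)
      (cmp (cob X 0) (cob X (Suc 0)) (cob Y 0) (mneg \<C> (cob X (Suc 0)) (cob Y 0) (h 0)) (cdf X 0))"
    by (subst e) (simp add: hom_simps)
  moreover have "g (Suc i) = madd \<C> (cob X (Suc i)) (cob Y (Suc i)) (f (Suc i))
       (madd \<C> (cob X (Suc i)) (cob Y (Suc i))
         (cmp (cob X (Suc i)) (cob Y i) (cob Y (Suc i)) (cdf Y i) (mneg \<C> (cob X (Suc i)) (cob Y i) (h i)))
         (cmp (cob X (Suc i)) (cob X (Suc (Suc i))) (cob Y (Suc i))
            (mneg \<C> (cob X (Suc (Suc i))) (cob Y (Suc i)) (h (Suc i))) (cdf X (Suc i))))"
    if "i < n" for i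
  proof -
    define b where "b = madd \<C> (cob X (Suc i)) (cob Y (Suc i))
         (cmp (cob X (Suc i)) (cob Y i) (cob Y (Suc i)) (cdf Y i) (h i))
         (cmp (cob X (Suc i)) (cob X (Suc (Suc i))) (cob Y (Suc i)) (h (Suc i)) (cdf X (Suc i)))"
    have b: "b \<in> mor \<C> (cob X (Suc i)) (cob Y (Suc i))"
      using that by (simp add: b_def hom_closed)
    have "madd \<C> (cob X (Suc i)) (cob Y (Suc i))
         (cmp (cob X (Suc i)) (cob Y i) (cob Y (Suc i)) (cdf Y i) (mneg \<C> (cob X (Suc i)) (cob Y i) (h i)))
         (cmp (cob X (Suc i)) (cob X (Suc (Suc i))) (cob Y (Suc i))
            (mneg \<C> (cob X (Suc (Suc i))) (cob Y (Suc i)) (h (Suc i))) (cdf X (Suc i)))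
      = mneg \<C> (cob X (Suc i)) (cob Y (Suc i)) b"
      using that by (simp add: b_def hom_simps)
    then show ?thesis
      using that b e(2)[OF that, folded b_def] by (simp add: hom_simps)
  qed
  moreover have "g (Suc n) = madd \<C> (cob X (Suc n)) (cob Y (Suc n)) (f (Suc n))
       (cmp (cob X (Suc n)) (cob Y n) (cob Y (Suc n)) (cdf Y n) (mneg \<C> (cob X (Suc n)) (cob Y n) (h n)))"
    by (subst e) (simp add: hom_simps)
  ultimately show ?thesis
    by (simp add: homotopy_def cmp_def hom_closed)
qed

lemma homotopic_sym:
  assumes "is_complex n \<C> X" "is_complex n \<C> Y"
    and "\<And>i. i \<le> Suc n \<Longrightarrow> f i \<in> mor \<C> (cob X i) (cob Y i)"
    and "\<And>i. i \<le> Suc n \<Longrightarrow> g i \<in> mor \<C> (cob X i) (cob Y i)"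
    and "homotopic n \<C> X Y f g"
  shows "homotopic n \<C> X Y g f"
  using assms(5) homotopic_iff_homotopy[OF assms(1-4)] homotopic_iff_homotopy[OF assms(1,2,4,3)]
    homotopy_sym[OF assms(1-4)] by blast

text \<open>
  The contravariant half of the exactness of an \<open>n\<close>-exangle, away from its extension group. It is
  all that the construction of homotopies needs, and, unlike being an \<open>n\<close>-exangle, it does not
  mention an extension.
\<close>

definition middle_exact :: "nat \<Rightarrow> ('o, 'm) cpx \<Rightarrow> bool"
  where "middle_exact n X \<longleftrightarrow> is_complex n \<C> X \<and>
    (\<forall>T\<in>Ob. \<forall>i<n. \<forall>x\<in>mor \<C> (cob X (Suc i)) T.
       x \<cdot> cdf X i = mzero \<C> (cob X i) T \<longrightarrow>
       (\<exists>y\<in>mor \<C> (cob X (Suc (Suc i))) T. x = y \<cdot> cdf X (Suc i)))"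

lemma middle_exactD:
  assumes "middle_exact n X" "T \<in> Ob" "i < n" "x \<in> mor \<C> (cob X (Suc i)) T"
    and "cmp (cob X i) (cob X (Suc i)) T x (cdf X i) = mzero \<C> (cob X i) T"
  obtains y where "y \<in> mor \<C> (cob X (Suc (Suc i))) T"
    and "x = cmp (cob X (Suc i)) (cob X (Suc (Suc i))) T y (cdf X (Suc i))"
  using assms unfolding middle_exact_def cmp_def by blast

lemma chain_map_comp:
  assumes "is_complex n \<C> X" "is_complex n \<C> Y" "is_complex n \<C> Z"
    and "chain_map n \<C> X Y f" "chain_map n \<C> Y Z g"
  shows "chain_map n \<C> X Z (\<lambda>i. g i \<cdot> f i)"
proof (rule chain_mapI)
  note [simp] = is_complexD[OF assms(1)] is_complexD[OF assms(2)] is_complexD[OF assms(3)]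
    chain_mapD[OF assms(4)] chain_mapD[OF assms(5)] hom_closed
  fix i
  show "g i \<cdot> f i \<in> mor \<C> (cob X i) (cob Z i)" if "i \<le> Suc n"
    using that comp_closed[of "cob X i" "cob Y i" "cob Z i"] by simp
  assume i: "i \<le> n"
  have "cmp (cob X i) (cob X (Suc i)) (cob Z (Suc i))
          (cmp (cob X (Suc i)) (cob Y (Suc i)) (cob Z (Suc i)) (g (Suc i)) (f (Suc i))) (cdf X i)
      = cmp (cob X i) (cob Y i) (cob Z (Suc i))
          (cmp (cob Y i) (cob Y (Suc i)) (cob Z (Suc i)) (g (Suc i)) (cdf Y i)) (f i)"
    using i by (simp add: hom_simps chain_map_cmp[OF assms(4)])
  also have "\<dots> = cmp (cob X i) (cob Z i) (cob Z (Suc i)) (cdf Z i)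
          (cmp (cob X i) (cob Y i) (cob Z i) (g i) (f i))"
    using i by (simp add: hom_simps chain_map_cmp[OF assms(5)])
  finally show "g (Suc i) \<cdot> f (Suc i) \<cdot> cdf X i = cdf Z i \<cdot> (g i \<cdot> f i)"
    by (simp add: cmp_def)
qed

text \<open>
  If \<open>1 = gf + dh + hd\<close> and \<open>x\<close> kills \<open>d\<close>, then \<open>x = xgf + xhd\<close>, and \<open>xg\<close> factors through the
  differential of \<open>X\<close>, because it kills the preceding one; so both summands factor through
  the differential of \<open>Y\<close>.
\<close>

lemma middle_exact_homotopy_retract:
  assumes "middle_exact n X" and Y: "is_complex n \<C> Y"
    and f: "chain_map n \<C> Y X f" and g: "chain_map n \<C> X Y g"
    and "homotopic n \<C> Y Y (\<lambda>i. g i \<cdot> f i) (\<lambda>i. ID (cob Y i))"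
  shows "middle_exact n Y"
proof -
  have X: "is_complex n \<C> X" using assms(1) by (simp add: middle_exact_def)
  note [simp] = is_complexD[OF X] is_complexD[OF Y] chain_mapD[OF f] chain_mapD[OF g]
    ident_closed
  have gf: "g i \<cdot> f i \<in> mor \<C> (cob Y i) (cob Y i)" if "i \<le> Suc n" for i
    using that comp_closed[of "cob Y i" "cob X i" "cob Y i"] by simp
  obtain h' where h': "homotopy n Y Y h' (\<lambda>i. g i \<cdot> f i) (\<lambda>i. ID (cob Y i))"
    using assms(5) homotopic_iff_homotopy[OF Y Y] gf by auto
  obtain h where h: "homotopy n Y Y h (\<lambda>i. ID (cob Y i)) (\<lambda>i. g i \<cdot> f i)"
    using homotopy_sym[OF Y Y _ _ h'] gf by auto
  have hm [simp]: "h i \<in> mor \<C> (cob Y (Suc i)) (cob Y i)" if "i \<le> n" for i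
    using h that by (simp add: homotopy_def)
  have "\<exists>y\<in>mor \<C> (cob Y (Suc (Suc i))) T. x = y \<cdot> cdf Y (Suc i)"
    if T [simp]: "T \<in> Ob" and i [simp]: "i < n" and x [simp]: "x \<in> mor \<C> (cob Y (Suc i)) T"
      and "x \<cdot> cdf Y i = mzero \<C> (cob Y i) T" for T i x
  proof -
    have i' [simp]: "i \<le> n" "Suc i \<le> n" "i \<le> Suc n" using i by linarith+
    have xd: "cmp (cob Y i) (cob Y (Suc i)) T x (cdf Y i) = mzero \<C> (cob Y i) T"
      using that by (simp add: cmp_def)
    have xd': "cmp Z (cob Y (Suc i)) T x (cmp Z (cob Y i) (cob Y (Suc i)) (cdf Y i) z) = mzero \<C> Z T"
      if "Z \<in> Ob" "z \<in> mor \<C> Z (cob Y i)" for Z z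
      using that by (simp add: hom_simps xd flip: cmp_assoc)
    have "cmp (cob X i) (cob X (Suc i)) T
            (cmp (cob X (Suc i)) (cob Y (Suc i)) T x (g (Suc i))) (cdf X i) = mzero \<C> (cob X i) T"
      by (simp add: hom_simps chain_map_cmp[OF g] xd')
    then obtain y where y [simp]: "y \<in> mor \<C> (cob X (Suc (Suc i))) T"
      and xy: "cmp (cob X (Suc i)) (cob Y (Suc i)) T x (g (Suc i))
        = cmp (cob X (Suc i)) (cob X (Suc (Suc i))) T y (cdf X (Suc i))"
      using middle_exactD[OF assms(1) T i, of "cmp (cob X (Suc i)) (cob Y (Suc i)) T x (g (Suc i))"]
      by (auto simp: hom_closed)
    have id: "ID (cob Y (Suc i)) = madd \<C> (cob Y (Suc i)) (cob Y (Suc i))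
       (cmp (cob Y (Suc i)) (cob X (Suc i)) (cob Y (Suc i)) (g (Suc i)) (f (Suc i)))
       (madd \<C> (cob Y (Suc i)) (cob Y (Suc i))
         (cmp (cob Y (Suc i)) (cob Y i) (cob Y (Suc i)) (cdf Y i) (h i))
         (cmp (cob Y (Suc i)) (cob Y (Suc (Suc i))) (cob Y (Suc i)) (h (Suc i)) (cdf Y (Suc i))))"
      using h i by (simp add: homotopy_def cmp_def)
    define z where "z = madd \<C> (cob Y (Suc (Suc i))) T
       (cmp (cob Y (Suc (Suc i))) (cob X (Suc (Suc i))) T y (f (Suc (Suc i))))
       (cmp (cob Y (Suc (Suc i))) (cob Y (Suc i)) T x (h (Suc i)))"
    have "x = cmp (cob Y (Suc i)) (cob Y (Suc i)) T x (ID (cob Y (Suc i)))"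
      by (simp add: cmp_ident)
    also have "\<dots> = madd \<C> (cob Y (Suc i)) T
       (cmp (cob Y (Suc i)) (cob X (Suc i)) T (cmp (cob X (Suc i)) (cob Y (Suc i)) T x (g (Suc i))) (f (Suc i)))
       (cmp (cob Y (Suc i)) (cob Y (Suc (Suc i))) T
          (cmp (cob Y (Suc (Suc i))) (cob Y (Suc i)) T x (h (Suc i))) (cdf Y (Suc i)))"
      by (subst id) (simp add: hom_simps xd')
    also have "\<dots> = cmp (cob Y (Suc i)) (cob Y (Suc (Suc i))) T z (cdf Y (Suc i))"
      by (subst xy) (simp add: z_def hom_simps chain_map_cmp[OF f])
    finally have "x = z \<cdot> cdf Y (Suc i)" by (simp add: cmp_def)
    moreover have "z \<in> mor \<C> (cob Y (Suc (Suc i))) T" by (simp add: z_def hom_closed)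
    ultimately show ?thesis by blast
  qed
  then show ?thesis
    using Y by (auto simp: middle_exact_def)
qed

text \<open>
  The homotopy is built from the left by successive extension. It stops short of the right end:
  nothing forces \<open>t (n + 1)\<close> to equal \<open>cdf X n \<cdot> k n\<close>, so \<open>t\<close> itself need not be null-homotopic
  even if \<open>t (n + 1)\<close> is zero.
\<close>

lemma middle_exact_null_homotopy:
  assumes "middle_exact n X" and t: "chain_map n \<C> X X t" and t0: "t 0 = mzero \<C> (cob X 0) (cob X 0)"
  obtains k where "\<And>i. i \<le> n \<Longrightarrow> k i \<in> mor \<C> (cob X (Suc i)) (cob X i)"
    and "k 0 = mzero \<C> (cob X 1) (cob X 0)"
    and "\<And>i. i < n \<Longrightarrow> t (Suc i) = madd \<C> (cob X (Suc i)) (cob X (Suc i))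
         (cdf X i \<cdot> k i) (k (Suc i) \<cdot> cdf X (Suc i))"
proof -
  have X: "is_complex n \<C> X" using assms(1) by (simp add: middle_exact_def)
  note [simp] = is_complexD[OF X] chain_mapD[OF t]
  \<comment> \<open>\<open>Q\<close> is the wanted equation in degree \<open>i + 1\<close>; the equation in \<open>P\<close> is its consequence which says
    that \<open>t (i + 1) - d k\<close> kills \<open>d\<close>, so that the next component of the homotopy exists.\<close>
  define P where "P = (\<lambda>i k. (i = 0 \<longrightarrow> k = mzero \<C> (cob X 1) (cob X 0)) \<and>
     (i \<le> n \<longrightarrow> k \<in> mor \<C> (cob X (Suc i)) (cob X i) \<and>
       cmp (cob X i) (cob X i) (cob X (Suc i)) (cdf X i) (t i) =
       cmp (cob X i) (cob X i) (cob X (Suc i)) (cdf X i)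
         (cmp (cob X i) (cob X (Suc i)) (cob X i) k (cdf X i))))"
  define Q where "Q = (\<lambda>i k k'. i < n \<longrightarrow> t (Suc i) = madd \<C> (cob X (Suc i)) (cob X (Suc i))
         (cmp (cob X (Suc i)) (cob X i) (cob X (Suc i)) (cdf X i) k)
         (cmp (cob X (Suc i)) (cob X (Suc (Suc i))) (cob X (Suc i)) k' (cdf X (Suc i))))"
  have "\<exists>k. \<forall>i. P i (k i) \<and> Q i (k i) (k (Suc i))"
  proof (rule dependent_nat_choice)
    show "\<exists>k. P 0 k" by (simp add: P_def t0 hom_simps)
    fix k i assume P: "P i k"
    show "\<exists>k'. P (Suc i) k' \<and> Q i k k'"
    proof (cases "i < n")
      case True
      have k [simp]: "k \<in> mor \<C> (cob X (Suc i)) (cob X i)"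
        and ti: "cmp (cob X i) (cob X i) (cob X (Suc i)) (cdf X i) (t i) =
         cmp (cob X i) (cob X i) (cob X (Suc i)) (cdf X i)
           (cmp (cob X i) (cob X (Suc i)) (cob X i) k (cdf X i))"
        using P True by (auto simp: P_def)
      let ?dk = "cmp (cob X (Suc i)) (cob X i) (cob X (Suc i)) (cdf X i) k"
      let ?x = "madd \<C> (cob X (Suc i)) (cob X (Suc i)) (t (Suc i))
        (mneg \<C> (cob X (Suc i)) (cob X (Suc i)) ?dk)"
      have x: "?x \<in> mor \<C> (cob X (Suc i)) (cob X (Suc i))"
        using True by (simp add: hom_closed)
      have "cmp (cob X i) (cob X (Suc i)) (cob X (Suc i)) ?x (cdf X i)
         = mzero \<C> (cob X i) (cob X (Suc i))"
        using True by (simp add: hom_simps chain_map_cmp[OF t] ti)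
      then obtain k' where k' [simp]: "k' \<in> mor \<C> (cob X (Suc (Suc i))) (cob X (Suc i))"
        and "?x = cmp (cob X (Suc i)) (cob X (Suc (Suc i))) (cob X (Suc i)) k' (cdf X (Suc i))"
        using middle_exactD[OF assms(1) _ True x] True by auto
      then have q: "t (Suc i) = madd \<C> (cob X (Suc i)) (cob X (Suc i)) ?dk
         (cmp (cob X (Suc i)) (cob X (Suc (Suc i))) (cob X (Suc i)) k' (cdf X (Suc i)))"
        using True by (subst (asm) hom_diff_eq_iff) (auto simp: hom_closed)
      have z: "cmp (cob X (Suc i)) (cob X (Suc i)) (cob X (Suc (Suc i))) (cdf X (Suc i)) ?dk
         = mzero \<C> (cob X (Suc i)) (cob X (Suc (Suc i)))"
        using True by (simp add: hom_simps is_complex_cmp[OF X] flip: cmp_assoc)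
      have "P (Suc i) k'"
        unfolding P_def using True by (subst q) (simp add: cmp_add hom_closed z hom_zero_add)
      moreover have "Q i k k'" using q by (simp add: Q_def)
      ultimately show ?thesis by blast
    next
      case False
      then have "Q i k k'" for k' by (simp add: Q_def)
      moreover have "\<exists>k'. P (Suc i) k'" using False by (simp add: P_def)
      ultimately show ?thesis by blast
    qed
  qed
  then obtain k where "\<And>i. P i (k i)" "\<And>i. Q i (k i) (k (Suc i))" by blast
  then show ?thesis
    by (intro that[of k]) (auto simp: P_def Q_def cmp_def)
qed

section \<open>Homotopy equivalences with fixed ends\<close>

lemma double_minus_square:
  assumes "X \<in> Ob" "h \<in> mor \<C> X X" and "t = madd \<C> X X h (mneg \<C> X X (ID X))"
  shows "madd \<C> X X h (madd \<C> X X h (mneg \<C> X X (cmp X X X h h)))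
    = madd \<C> X X (ID X) (mneg \<C> X X (cmp X X X t t))"
proof -
  note [simp] = assms(1,2) hom_closed
  have "madd \<C> X X (madd \<C> X X h (madd \<C> X X h (mneg \<C> X X (cmp X X X h h)))) (mneg \<C> X X (ID X))
    = mneg \<C> X X (cmp X X X t t)"
    by (simp add: assms(3) hom_simps hom_add_comm hom_add_left_comm)
  then show ?thesis
    by (subst (asm) hom_diff_eq_iff) (auto simp: assms(3))
qed

text \<open>
  Here \<open>2h - hh = 1 - tt\<close> for \<open>t = h - 1\<close>, which vanishes at both ends. With \<open>t = dk + kd\<close> in the middle
  degrees, \<open>tt = d(tk) + (tk)d\<close> there, and at the right end \<open>d(tk) = t(dk) = 0 = tt\<close>: multiplication
  by \<open>t\<close> removes the defect of \<open>k\<close>. Hence \<open>-tk\<close> is a homotopy from \<open>1 - tt\<close> to \<open>1\<close>.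
\<close>

lemma homotopy_inverse_of_endomorphism:
  assumes "middle_exact n X" and h: "chain_map n \<C> X X h"
    and "h 0 = ID (cob X 0)" "h (Suc n) = ID (cob X (Suc n))"
  shows "homotopic n \<C> X X
    (\<lambda>i. madd \<C> (cob X i) (cob X i) (h i) (madd \<C> (cob X i) (cob X i) (h i)
       (mneg \<C> (cob X i) (cob X i) (h i \<cdot> h i)))) (\<lambda>i. ID (cob X i))"
proof -
  have X: "is_complex n \<C> X" using assms(1) by (simp add: middle_exact_def)
  note [simp] = is_complexD[OF X] chain_mapD(1)[OF h] hom_closed
  define t where "t = (\<lambda>i. madd \<C> (cob X i) (cob X i) (h i) (mneg \<C> (cob X i) (cob X i) (ID (cob X i))))"
  have tm [simp]: "t i \<in> mor \<C> (cob X i) (cob X i)" if "i \<le> Suc n" for i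
    using that by (simp add: t_def)
  have t: "chain_map n \<C> X X t"
  proof (rule chain_mapI)
    fix i assume i: "i \<le> n"
    have "cmp (cob X i) (cob X (Suc i)) (cob X (Suc i)) (t (Suc i)) (cdf X i)
      = cmp (cob X i) (cob X i) (cob X (Suc i)) (cdf X i) (t i)"
      using i by (simp add: t_def hom_simps chain_map_cmp[OF h])
    then show "t (Suc i) \<cdot> cdf X i = cdf X i \<cdot> t i" by (simp add: cmp_def)
  qed simp
  have t0: "t 0 = mzero \<C> (cob X 0) (cob X 0)"
    and tn: "t (Suc n) = mzero \<C> (cob X (Suc n)) (cob X (Suc n))"
    by (simp_all add: t_def assms(3,4) hom_simps)
  obtain k where k [simp]: "\<And>i. i \<le> n \<Longrightarrow> k i \<in> mor \<C> (cob X (Suc i)) (cob X i)"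
    and k0: "k 0 = mzero \<C> (cob X 1) (cob X 0)"
    and tk: "\<And>i. i < n \<Longrightarrow> t (Suc i) = madd \<C> (cob X (Suc i)) (cob X (Suc i))
         (cdf X i \<cdot> k i) (k (Suc i) \<cdot> cdf X (Suc i))"
    using middle_exact_null_homotopy[OF assms(1) t t0] by metis
  define l where "l = (\<lambda>i. mneg \<C> (cob X (Suc i)) (cob X i)
    (cmp (cob X (Suc i)) (cob X i) (cob X i) (t i) (k i)))"
  define u where "u = (\<lambda>i. madd \<C> (cob X i) (cob X i) (h i) (madd \<C> (cob X i) (cob X i) (h i)
       (mneg \<C> (cob X i) (cob X i) (cmp (cob X i) (cob X i) (cob X i) (h i) (h i)))))"
  have u: "u i = madd \<C> (cob X i) (cob X i) (ID (cob X i))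
      (mneg \<C> (cob X i) (cob X i) (cmp (cob X i) (cob X i) (cob X i) (t i) (t i)))"
    if "i \<le> Suc n" for i
    using that unfolding u_def by (intro double_minus_square) (auto simp: t_def)
  have "homotopy n X X l u (\<lambda>i. ID (cob X i))"
    unfolding homotopy_def
  proof (intro conjI allI impI)
    show "l i \<in> mor \<C> (cob X (Suc i)) (cob X i)" if "i \<le> n" for i
      using that by (simp add: l_def)
    show "u 0 = madd \<C> (cob X 0) (cob X 0) (ID (cob X 0)) (l 0 \<cdot> cdf X 0)"
      by (simp add: u flip: cmp_def[of "cob X 0" "cob X (Suc 0)" "cob X 0"])
        (simp add: l_def t0 hom_simps)
    show "u (Suc n) = madd \<C> (cob X (Suc n)) (cob X (Suc n)) (ID (cob X (Suc n))) (cdf X n \<cdot> l n)"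
      by (simp add: u flip: cmp_def[of "cob X (Suc n)" "cob X n" "cob X (Suc n)"])
        (simp add: l_def tn hom_simps chain_map_cmp[OF t, symmetric] flip: cmp_assoc)
    fix i assume i: "i < n"
    have tt: "cmp (cob X (Suc i)) (cob X (Suc i)) (cob X (Suc i)) (t (Suc i)) (t (Suc i))
      = madd \<C> (cob X (Suc i)) (cob X (Suc i))
          (cmp (cob X (Suc i)) (cob X i) (cob X (Suc i)) (cdf X i)
            (cmp (cob X (Suc i)) (cob X i) (cob X i) (t i) (k i)))
          (cmp (cob X (Suc i)) (cob X (Suc (Suc i))) (cob X (Suc i))
            (cmp (cob X (Suc (Suc i))) (cob X (Suc i)) (cob X (Suc i)) (t (Suc i)) (k (Suc i)))
            (cdf X (Suc i)))"
    proof -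
      have eq: "t (Suc i) = madd \<C> (cob X (Suc i)) (cob X (Suc i))
         (cmp (cob X (Suc i)) (cob X i) (cob X (Suc i)) (cdf X i) (k i))
         (cmp (cob X (Suc i)) (cob X (Suc (Suc i))) (cob X (Suc i)) (k (Suc i)) (cdf X (Suc i)))"
        using tk[OF i] by (simp add: cmp_def)
      have "cmp (cob X (Suc i)) (cob X (Suc i)) (cob X (Suc i)) (t (Suc i)) (t (Suc i))
        = madd \<C> (cob X (Suc i)) (cob X (Suc i))
          (cmp (cob X (Suc i)) (cob X i) (cob X (Suc i))
            (cmp (cob X i) (cob X (Suc i)) (cob X (Suc i)) (t (Suc i)) (cdf X i)) (k i))
          (cmp (cob X (Suc i)) (cob X (Suc (Suc i))) (cob X (Suc i))
            (cmp (cob X (Suc (Suc i))) (cob X (Suc i)) (cob X (Suc i)) (t (Suc i)) (k (Suc i)))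
            (cdf X (Suc i)))"
        using i by (subst (2) eq) (simp add: cmp_add cmp_assoc)
      then show ?thesis
        using i by (simp add: chain_map_cmp[OF t] cmp_assoc)
    qed
    have "u (Suc i) = madd \<C> (cob X (Suc i)) (cob X (Suc i)) (ID (cob X (Suc i)))
       (madd \<C> (cob X (Suc i)) (cob X (Suc i))
         (cmp (cob X (Suc i)) (cob X i) (cob X (Suc i)) (cdf X i) (l i))
         (cmp (cob X (Suc i)) (cob X (Suc (Suc i))) (cob X (Suc i)) (l (Suc i)) (cdf X (Suc i))))"
      using i by (simp add: u tt) (simp add: l_def hom_simps)
    then show "u (Suc i) = madd \<C> (cob X (Suc i)) (cob X (Suc i)) (ID (cob X (Suc i)))
       (madd \<C> (cob X (Suc i)) (cob X (Suc i)) (cdf X i \<cdot> l i) (l (Suc i) \<cdot> cdf X (Suc i)))"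
      by (simp add: cmp_def)
  qed
  then have "homotopic n \<C> X X u (\<lambda>i. ID (cob X i))"
    by (subst homotopic_iff_homotopy[OF X X]) (auto simp: u_def)
  then show ?thesis by (simp add: u_def cmp_def)
qed

text \<open>
  The homotopy inverse of \<open>f\<close> is \<open>2g - gfg\<close>: its composites with \<open>f\<close> are \<open>2h - hh\<close> for \<open>h = gf\<close> and for
  \<open>h = fg\<close>.
\<close>

lemma homotopy_equivalentI:
  assumes "middle_exact n X" "middle_exact n Y"
    and "cob X 0 = A" "cob Y 0 = A" "cob X (Suc n) = C" "cob Y (Suc n) = C"
    and "chain_map_between n \<C> A C X Y f" "chain_map_between n \<C> A C Y X g"
  shows "homotopy_equivalent n \<C> A C X Y"
proof -
  have X: "is_complex n \<C> X" and Y: "is_complex n \<C> Y"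
    using assms(1,2) by (auto simp: middle_exact_def)
  have f: "chain_map n \<C> X Y f" "f 0 = ID A" "f (Suc n) = ID C"
    and g: "chain_map n \<C> Y X g" "g 0 = ID A" "g (Suc n) = ID C"
    using assms(7,8) by (auto simp: chain_map_between_def)
  note [simp] = is_complexD[OF X] is_complexD[OF Y] chain_mapD(1)[OF f(1)] chain_mapD(1)[OF g(1)] hom_closed
  have AC [simp]: "A \<in> Ob" "C \<in> Ob" using assms(3,5) is_complexD(1)[OF X] by fastforce+
  have ii [simp]: "ID A \<cdot> ID A = ID A" "ID C \<cdot> ID C = ID C"
    using comp_ident_left[of A A "ID A"] comp_ident_left[of C C "ID C"] by simp_all
  define g' where "g' = (\<lambda>i. madd \<C> (cob Y i) (cob X i) (g i) (madd \<C> (cob Y i) (cob X i) (g i)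
      (mneg \<C> (cob Y i) (cob X i) (cmp (cob Y i) (cob Y i) (cob X i) (g i)
         (cmp (cob Y i) (cob X i) (cob Y i) (f i) (g i))))))"
  have g'm: "g' i \<in> mor \<C> (cob Y i) (cob X i)" if "i \<le> Suc n" for i
    using that by (simp add: g'_def)
  have "chain_map n \<C> Y X g'"
  proof (rule chain_mapI)
    fix i assume i: "i \<le> n"
    have fr: "cmp (cob Y i) (cob X (Suc i)) (cob Y (Suc i)) (f (Suc i))
                (cmp (cob Y i) (cob X i) (cob X (Suc i)) (cdf X i) (g i))
      = cmp (cob Y i) (cob Y i) (cob Y (Suc i)) (cdf Y i)
                (cmp (cob Y i) (cob X i) (cob Y i) (f i) (g i))"
      using i by (simp add: chain_map_cmp[OF f(1)] flip: cmp_assoc)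
    have gr: "cmp (cob Y i) (cob Y (Suc i)) (cob X (Suc i)) (g (Suc i))
                (cmp (cob Y i) (cob Y i) (cob Y (Suc i)) (cdf Y i) z)
      = cmp (cob Y i) (cob X i) (cob X (Suc i)) (cdf X i)
                (cmp (cob Y i) (cob Y i) (cob X i) (g i) z)" if "z \<in> mor \<C> (cob Y i) (cob Y i)" for z
      using i that by (simp add: chain_map_cmp[OF g(1)] flip: cmp_assoc)
    have "cmp (cob Y i) (cob Y (Suc i)) (cob X (Suc i)) (g' (Suc i)) (cdf Y i)
      = cmp (cob Y i) (cob X i) (cob X (Suc i)) (cdf X i) (g' i)"
      using i by (simp add: g'_def hom_simps chain_map_cmp[OF g(1)] fr gr)
    then show "g' (Suc i) \<cdot> cdf Y i = cdf X i \<cdot> g' i" by (simp add: cmp_def)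
  qed (rule g'm)
  moreover have "g' 0 = ID A" "g' (Suc n) = ID C"
    by (simp_all add: g'_def f g assms(3-6) hom_simps)
  moreover have "homotopic n \<C> X X (\<lambda>i. g' i \<cdot> f i) (\<lambda>i. ID (cob X i))"
  proof -
    have *: "g' i \<cdot> f i = madd \<C> (cob X i) (cob X i) (g i \<cdot> f i) (madd \<C> (cob X i) (cob X i) (g i \<cdot> f i)
       (mneg \<C> (cob X i) (cob X i) (g i \<cdot> f i \<cdot> (g i \<cdot> f i))))" if "i \<le> Suc n" for i
    proof -
      have "cmp (cob X i) (cob Y i) (cob X i) (g' i) (f i)
        = madd \<C> (cob X i) (cob X i) (cmp (cob X i) (cob Y i) (cob X i) (g i) (f i))
         (madd \<C> (cob X i) (cob X i) (cmp (cob X i) (cob Y i) (cob X i) (g i) (f i))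
       (mneg \<C> (cob X i) (cob X i) (cmp (cob X i) (cob X i) (cob X i)
          (cmp (cob X i) (cob Y i) (cob X i) (g i) (f i))
          (cmp (cob X i) (cob Y i) (cob X i) (g i) (f i)))))"
        using that by (simp add: g'_def hom_simps)
      then show ?thesis by (simp add: cmp_def)
    qed
    have "homotopic n \<C> X X (\<lambda>i. madd \<C> (cob X i) (cob X i) (g i \<cdot> f i) (madd \<C> (cob X i) (cob X i) (g i \<cdot> f i)
       (mneg \<C> (cob X i) (cob X i) (g i \<cdot> f i \<cdot> (g i \<cdot> f i))))) (\<lambda>i. ID (cob X i))"
      using f g assms(3-6) chain_map_comp[OF X Y X f(1) g(1)]
      by (intro homotopy_inverse_of_endomorphism[OF assms(1)]) simp_all
    then show ?thesis
      unfolding homotopic_def null_homotopic_def by (simp add: *)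
  qed
  moreover have "homotopic n \<C> Y Y (\<lambda>i. f i \<cdot> g' i) (\<lambda>i. ID (cob Y i))"
  proof -
    have *: "f i \<cdot> g' i = madd \<C> (cob Y i) (cob Y i) (f i \<cdot> g i) (madd \<C> (cob Y i) (cob Y i) (f i \<cdot> g i)
       (mneg \<C> (cob Y i) (cob Y i) (f i \<cdot> g i \<cdot> (f i \<cdot> g i))))" if "i \<le> Suc n" for i
    proof -
      have "cmp (cob Y i) (cob X i) (cob Y i) (f i) (g' i)
        = madd \<C> (cob Y i) (cob Y i) (cmp (cob Y i) (cob X i) (cob Y i) (f i) (g i))
         (madd \<C> (cob Y i) (cob Y i) (cmp (cob Y i) (cob X i) (cob Y i) (f i) (g i))
       (mneg \<C> (cob Y i) (cob Y i) (cmp (cob Y i) (cob Y i) (cob Y i)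
          (cmp (cob Y i) (cob X i) (cob Y i) (f i) (g i))
          (cmp (cob Y i) (cob X i) (cob Y i) (f i) (g i)))))"
        using that by (simp add: g'_def hom_simps)
      then show ?thesis by (simp add: cmp_def)
    qed
    have "homotopic n \<C> Y Y (\<lambda>i. madd \<C> (cob Y i) (cob Y i) (f i \<cdot> g i) (madd \<C> (cob Y i) (cob Y i) (f i \<cdot> g i)
       (mneg \<C> (cob Y i) (cob Y i) (f i \<cdot> g i \<cdot> (f i \<cdot> g i))))) (\<lambda>i. ID (cob Y i))"
      using f g assms(3-6) chain_map_comp[OF Y X Y g(1) f(1)]
      by (intro homotopy_inverse_of_endomorphism[OF assms(2)]) simp_all
    then show ?thesis
      unfolding homotopic_def null_homotopic_def by (simp add: *)
  qed
  ultimately show ?thesis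
    using assms(7) unfolding homotopy_equivalent_def chain_map_between_def by auto
qed

text \<open>
  Membership in a homotopy class of an exact complex amounts to the existence of chain maps in
  both directions, and these compose; so no composition of homotopies is needed.
\<close>

lemma hclass_subset:
  assumes "middle_exact n X" "middle_exact n Y"
    and ends: "cob X 0 = A" "cob Y 0 = A" "cob X (Suc n) = C" "cob Y (Suc n) = C"
    and f: "chain_map_between n \<C> A C X Y f" and g: "chain_map_between n \<C> A C Y X g"
  shows "hclass n \<C> X \<subseteq> hclass n \<C> Y"
proof
  fix W assume "W \<in> hclass n \<C> X"
  then obtain p q where W: "complex_between n \<C> A C W"
    and p: "chain_map_between n \<C> A C X W p" and q: "chain_map_between n \<C> A C W X q"
    and pq: "homotopic n \<C> W W (\<lambda>i. p i \<cdot> q i) (\<lambda>i. ID (cob W i))"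
    by (auto simp: hclass_def homotopy_equivalent_def ends)
  have XYW: "is_complex n \<C> X" "is_complex n \<C> Y" "is_complex n \<C> W"
    using assms(1,2) W by (auto simp: middle_exact_def complex_between_def)
  have AC: "A \<in> Ob" "C \<in> Ob" using ends is_complexD(1)[OF XYW(1)] by fastforce+
  have comp: "chain_map_between n \<C> A C U W (\<lambda>i. v i \<cdot> u i)"
    if "is_complex n \<C> U" "is_complex n \<C> V" "is_complex n \<C> W"
      "chain_map_between n \<C> A C U V u" "chain_map_between n \<C> A C V W v" for U V W u v
    using that AC chain_map_comp[of n U V W u v]
    using comp_ident_left[of A A "ID A"] comp_ident_left[of C C "ID C"]
    by (auto simp: chain_map_between_def ident_closed)
  have "middle_exact n W"
    using middle_exact_homotopy_retract[OF assms(1) XYW(3) _ _ pq] p q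
    by (auto simp: chain_map_between_def)
  then have "homotopy_equivalent n \<C> A C Y W"
    using W comp[OF XYW(2,1,3) g p] comp[OF XYW(3,1,2) q f] assms(2) ends
    by (intro homotopy_equivalentI) (auto simp: complex_between_def)
  then show "W \<in> hclass n \<C> Y"
    using W by (auto simp: hclass_def ends)
qed

lemma hclass_eqI:
  assumes "middle_exact n X" "middle_exact n Y"
    and "cob X 0 = A" "cob Y 0 = A" "cob X (Suc n) = C" "cob Y (Suc n) = C"
    and "chain_map_between n \<C> A C X Y f" and "chain_map_between n \<C> A C Y X g"
  shows "hclass n \<C> X = hclass n \<C> Y"
  using hclass_subset[of n X Y A C f g] hclass_subset[of n Y X A C g f] assms by blast

text \<open>
  Adding the null-homotopic map given by a homotopy concentrated in the last degree. This is used
  to adjust the last component of a chain map.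
\<close>

lemma chain_map_add_end:
  assumes X: "is_complex n \<C> X" and Y: "is_complex n \<C> Y" and u: "chain_map n \<C> X Y u" and "n \<ge> 1"
    and [simp]: "\<tau> \<in> mor \<C> (cob X (Suc n)) (cob Y n)"
  shows "chain_map n \<C> X Y
    (\<lambda>i. if i = n then madd \<C> (cob X n) (cob Y n) (u n) (\<tau> \<cdot> cdf X n)
         else if i = Suc n then madd \<C> (cob X (Suc n)) (cob Y (Suc n)) (u (Suc n)) (cdf Y n \<cdot> \<tau>)
         else u i)"
proof -
  note [simp] = is_complexD[OF X] is_complexD[OF Y] chain_mapD(1)[OF u] hom_closed
  define v where "v = (\<lambda>i. if i = n then madd \<C> (cob X n) (cob Y n) (u n)
          (cmp (cob X n) (cob X (Suc n)) (cob Y n) \<tau> (cdf X n))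
         else if i = Suc n then madd \<C> (cob X (Suc n)) (cob Y (Suc n)) (u (Suc n))
          (cmp (cob X (Suc n)) (cob Y n) (cob Y (Suc n)) (cdf Y n) \<tau>)
         else u i)"
  have "chain_map n \<C> X Y v"
  proof (rule chain_mapI)
    show "v i \<in> mor \<C> (cob X i) (cob Y i)" if "i \<le> Suc n" for i
      using that by (auto simp: v_def)
    fix i assume i: "i \<le> n"
    consider "i = n" | "Suc i = n" | "Suc i < n" using i by linarith
    then have "cmp (cob X i) (cob X (Suc i)) (cob Y (Suc i)) (v (Suc i)) (cdf X i)
      = cmp (cob X i) (cob Y i) (cob Y (Suc i)) (cdf Y i) (v i)"
    proof cases
      case 1
      then show ?thesis by (simp add: v_def hom_simps chain_map_cmp[OF u])
    next
      case 2
      have "cdf X i \<in> mor \<C> (cob X i) (cob X n)" "cdf Y i \<in> mor \<C> (cob Y i) (cob Y n)"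
        using is_complexD(2)[OF X, of i] is_complexD(2)[OF Y, of i] 2 by simp_all
      then show ?thesis
        using is_complex_cmp[OF X, of i] chain_map_cmp[OF u, of i] 2 i
        by (simp add: v_def hom_simps)
    next
      case 3
      then show ?thesis by (simp add: v_def chain_map_cmp[OF u])
    qed
    then show "v (Suc i) \<cdot> cdf X i = cdf Y i \<cdot> v i" by (simp add: cmp_def)
  qed
  then show ?thesis unfolding v_def cmp_def .
qed

end

section \<open>Extensions and conflations\<close>

context biadditive_functor
begin

lemma pull_closed:
  assumes "A \<in> Ob" "C \<in> Ob" "D \<in> Ob" "c \<in> mor \<C> D C" "\<delta> \<in> carrier (ext G C A)"
  shows "pull \<C> G A c \<delta> \<in> carrier (ext G D A)"
  using hom_in_carrier[OF ext_map_hom[OF assms(1,1,2,3) ident_closed assms(4)] assms(5)] assms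
  by (simp add: pull_def)

lemma push_closed:
  assumes "A \<in> Ob" "B \<in> Ob" "C \<in> Ob" "a \<in> mor \<C> A B" "\<delta> \<in> carrier (ext G C A)"
  shows "push \<C> G C a \<delta> \<in> carrier (ext G C B)"
  using hom_in_carrier[OF ext_map_hom[OF assms(1-3,3,4) ident_closed] assms(5)] assms
  by (simp add: push_def)

lemma pull_comp:
  assumes "A \<in> Ob" "C \<in> Ob" "D \<in> Ob" "E \<in> Ob" "c \<in> mor \<C> D C" "d \<in> mor \<C> E D"
    and "\<delta> \<in> carrier (ext G C A)"
  shows "pull \<C> G A (c \<cdot> d) \<delta> = pull \<C> G A d (pull \<C> G A c \<delta>)"
  using ext_map_comp[OF assms(1,1,1-4) ident_closed ident_closed assms(5-7)] assms
  comp_ident_left[of A A "ID A"]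
  by (simp add: pull_def ident_closed)

lemma pull_ident: "\<lbrakk>A \<in> Ob; C \<in> Ob; \<delta> \<in> carrier (ext G C A)\<rbrakk> \<Longrightarrow> pull \<C> G A (ID C) \<delta> = \<delta>"
  by (simp add: pull_def ext_map_ident)

lemma push_ident: "\<lbrakk>A \<in> Ob; C \<in> Ob; \<delta> \<in> carrier (ext G C A)\<rbrakk> \<Longrightarrow> push \<C> G C (ID A) \<delta> = \<delta>"
  by (simp add: push_def ext_map_ident)

lemma pull_add:
  assumes "A \<in> Ob" "C \<in> Ob" "D \<in> Ob" "c \<in> mor \<C> D C" "c' \<in> mor \<C> D C" "\<delta> \<in> carrier (ext G C A)"
  shows "pull \<C> G A (madd \<C> D C c c') \<delta> = pull \<C> G A c \<delta> \<otimes>\<^bsub>ext G D A\<^esub> pull \<C> G A c' \<delta>"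
  using ext_map_add_left[OF assms(1,1-3) ident_closed assms(4-6)] assms by (simp add: pull_def)

lemma pull_zero:
  assumes "A \<in> Ob" "C \<in> Ob" "D \<in> Ob" "c \<in> mor \<C> D C"
  shows "pull \<C> G A c \<one>\<^bsub>ext G C A\<^esub> = \<one>\<^bsub>ext G D A\<^esub>"
proof -
  interpret CA: comm_group "ext G C A" by (rule ext_comm_group) fact+
  interpret DA: comm_group "ext G D A" by (rule ext_comm_group) fact+
  show ?thesis
    using hom_one[OF ext_map_hom[OF assms(1,1-3) ident_closed assms(4)]] assms(1)
      CA.is_group DA.is_group by (simp add: pull_def)
qed

lemma exangle_middle_exact:
  assumes "exangle n \<C> G X \<delta>"
  shows "middle_exact n X"
  unfolding middle_exact_def
proof (intro conjI ballI allI impI)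
  show "is_complex n \<C> X" using assms by (simp add: exangle_def)
  fix T i x
  assume T: "T \<in> Ob" and i: "i < n" and x: "x \<in> mor \<C> (cob X (Suc i)) T"
    and "x \<cdot> cdf X i = mzero \<C> (cob X i) T"
  then have "x \<in> kernel (Hom (cob X (Suc i)) T) (Hom (cob X (Suc i - 1)) T) (\<lambda>g. g \<cdot> cdf X (Suc i - 1))"
    by (simp add: kernel_def)
  also have "\<dots> = (\<lambda>g. g \<cdot> cdf X (Suc i)) ` mor \<C> (cob X (Suc i + 1)) T"
  proof -
    have "\<forall>T\<in>Ob.
       (\<forall>i\<in>{1..n}. kernel (Hom (cob X i) T) (Hom (cob X (i-1)) T) (\<lambda>g. g \<cdot> cdf X (i-1))
                    = (\<lambda>g. g \<cdot> cdf X i) ` mor \<C> (cob X (i+1)) T) \<and>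
       kernel (Hom (cob X 0) T) (ext G (cob X (n+1)) T) (\<lambda>g. push \<C> G (cob X (n+1)) g \<delta>)
         = (\<lambda>g. g \<cdot> cdf X 0) ` mor \<C> (cob X 1) T"
      using assms unfolding exangle_def by (elim conjE) assumption
    moreover have "Suc i \<in> {1..n}" using i by simp
    ultimately show ?thesis using T by (meson bspec conjunct1)
  qed
  finally show "\<exists>y\<in>mor \<C> (cob X (Suc (Suc i))) T. x = y \<cdot> cdf X (Suc i)" by auto
qed

lemma exangle_lift_end:
  assumes "exangle n \<C> G X \<delta>" "T \<in> Ob" "t \<in> mor \<C> T (cob X (Suc n))"
    and "pull \<C> G (cob X 0) t \<delta> = \<one>\<^bsub>ext G T (cob X 0)\<^esub>"
  obtains \<tau> where "\<tau> \<in> mor \<C> T (cob X n)" "cdf X n \<cdot> \<tau> = t"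
proof -
  have "kernel (Hom T (cob X (n+1))) (ext G T (cob X 0)) (\<lambda>f. pull \<C> G (cob X 0) f \<delta>)
         = (\<lambda>f. cdf X n \<cdot> f) ` mor \<C> T (cob X n)"
  proof -
    have "\<forall>T\<in>Ob.
       (\<forall>i\<in>{1..n}. kernel (Hom T (cob X i)) (Hom T (cob X (i+1))) (\<lambda>f. cdf X i \<cdot> f)
                    = (\<lambda>f. cdf X (i-1) \<cdot> f) ` mor \<C> T (cob X (i-1))) \<and>
       kernel (Hom T (cob X (n+1))) (ext G T (cob X 0)) (\<lambda>f. pull \<C> G (cob X 0) f \<delta>)
         = (\<lambda>f. cdf X n \<cdot> f) ` mor \<C> T (cob X n)"
      using assms(1) unfolding exangle_def by (elim conjE) assumption
    then show ?thesis using assms(2) by (meson bspec conjunct2)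
  qed
  moreover have "t \<in> kernel (Hom T (cob X (n+1))) (ext G T (cob X 0)) (\<lambda>f. pull \<C> G (cob X 0) f \<delta>)"
    using assms(3,4) by (simp add: kernel_def)
  ultimately show ?thesis using that by auto
qed

end

context exact_realisation
begin

lemma distinguishedE:
  assumes "C \<in> Ob" "A \<in> Ob" "\<delta> \<in> carrier (ext G C A)"
  obtains X where "distinguished n \<C> G r X \<delta>" "cob X 0 = A" "cob X (Suc n) = C"
  using realises[OF assms] assms(3) by (auto simp: distinguished_def complex_between_def)

text \<open>
  Write \<open>c\<close> and \<open>c'\<close> for the last components of \<open>\<iota>\<close> and \<open>\<pi>\<close>, and let \<open>B\<close> realise \<open>\<rho> = c\<^sup>*\<epsilon>\<close>. The composites
  \<open>Q \<rightarrow> N \<rightarrow> B\<close> and \<open>B \<rightarrow> N \<rightarrow> Q\<close> end in \<open>c'c\<close> instead of the identity. The difference \<open>t = 1 - c'c\<close> factors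
  through the last differential of \<open>Q\<close> by the homotopy, and through that of \<open>B\<close> because
  \<open>(c'c)\<^sup>*\<rho> = c\<^sup>*(cc')\<^sup>*\<epsilon> = \<rho>\<close>, that is \<open>t\<^sup>*\<rho> = 0\<close>. So both composites can be corrected by null-homotopic
  maps. The hypothesis \<open>stable\<close> says that \<open>(1, cc')\<close> is an endomorphism of \<open>\<epsilon>\<close>.
\<close>

lemma distinguished_homotopy_retract:
  assumes "n \<ge> 1" and N: "distinguished n \<C> G r N \<epsilon>" and Q: "is_complex n \<C> Q"
    and \<iota>: "chain_map n \<C> Q N \<iota>" and \<pi>: "chain_map n \<C> N Q \<pi>"
    and A: "cob N 0 = A" "cob Q 0 = A" "\<iota> 0 = ID A" "\<pi> 0 = ID A"
    and retract: "homotopic n \<C> Q Q (\<lambda>i. \<pi> i \<cdot> \<iota> i) (\<lambda>i. ID (cob Q i))"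
    and stable: "pull \<C> G A (\<iota> (Suc n) \<cdot> \<pi> (Suc n)) \<epsilon> = \<epsilon>"
  shows "distinguished n \<C> G r Q (pull \<C> G A (\<iota> (Suc n)) \<epsilon>)"
proof -
  define c c' C D \<rho> where defs: "c = \<iota> (Suc n)" "c' = \<pi> (Suc n)" "C = cob N (Suc n)"
    "D = cob Q (Suc n)" "\<rho> = pull \<C> G A c \<epsilon>"
  have Nc: "is_complex n \<C> N" and \<epsilon>: "\<epsilon> \<in> carrier (ext G C A)"
    using N A by (auto simp: distinguished_def defs)
  have ob [simp]: "A \<in> Ob" "C \<in> Ob" "D \<in> Ob"
    using is_complexD(1)[OF Nc, of 0] is_complexD(1)[OF Nc, of "Suc n"]
      is_complexD(1)[OF Q, of "Suc n"] A by (simp_all add: defs)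
  have c [simp]: "c \<in> mor \<C> D C" and c' [simp]: "c' \<in> mor \<C> C D"
    using chain_mapD(1)[OF \<iota>, of "Suc n"] chain_mapD(1)[OF \<pi>, of "Suc n"] by (simp_all add: defs)
  have \<rho>: "\<rho> \<in> carrier (ext G D A)" using \<epsilon> pull_closed[of A C D c \<epsilon>] by (simp add: defs(5))
  obtain B where B: "distinguished n \<C> G r B \<rho>" and B0: "cob B 0 = A" and B1: "cob B (Suc n) = D"
    using distinguishedE[OF _ _ \<rho>] by auto
  have Bc: "is_complex n \<C> B" using B by (simp add: distinguished_def)
  have c'\<rho>: "pull \<C> G A c' \<rho> = \<epsilon>"
    using stable pull_comp[OF ob(1,2,3,2) c c' \<epsilon>] by (simp add: defs)
  obtain a where a: "chain_map n \<C> N B a" "a 0 = ID A" "a (Suc n) = c'"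
    using R0[OF N B, of "ID A" c'] A B0 B1 \<epsilon> c'\<rho> push_ident[of A C \<epsilon>]
    by (auto simp: ext_morphism_def ident_closed simp flip: defs)
  obtain b where b: "chain_map n \<C> B N b" "b 0 = ID A" "b (Suc n) = c"
    using R0[OF B N, of "ID A" c] A B0 B1 \<rho> push_ident[of A D \<rho>]
    by (auto simp: ext_morphism_def ident_closed simp flip: defs)
  have gf: "\<pi> i \<cdot> \<iota> i \<in> mor \<C> (cob Q i) (cob Q i)" if "i \<le> Suc n" for i
    using that comp_closed[of "cob Q i" "cob N i" "cob Q i"] is_complexD(1)[OF Q] is_complexD(1)[OF Nc]
      chain_mapD(1)[OF \<iota>] chain_mapD(1)[OF \<pi>] by simp
  note id_mor = ident_closed[OF is_complexD(1)[OF Q]]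
  obtain h' where h': "homotopy n Q Q h' (\<lambda>i. \<pi> i \<cdot> \<iota> i) (\<lambda>i. ID (cob Q i))"
    using retract homotopic_iff_homotopy[OF Q Q gf id_mor] by blast
  obtain h where h: "homotopy n Q Q h (\<lambda>i. ID (cob Q i)) (\<lambda>i. \<pi> i \<cdot> \<iota> i)"
    using homotopy_sym[OF Q Q gf id_mor h'] by blast
  define \<sigma> t where "\<sigma> = h n" and "t = cdf Q n \<cdot> \<sigma>"
  have \<sigma>: "\<sigma> \<in> mor \<C> D (cob Q n)" using h by (simp add: homotopy_def \<sigma>_def defs)
  have t: "t \<in> mor \<C> D D"
    using comp_closed[of D "cob Q n" D \<sigma> "cdf Q n"] \<sigma> is_complexD(1,2)[OF Q]
    by (simp add: t_def defs)
  have idD: "ID D = madd \<C> D D (c' \<cdot> c) t"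
    using h by (simp add: homotopy_def defs t_def \<sigma>_def)
  have "pull \<C> G A t \<rho> = \<one>\<^bsub>ext G D A\<^esub>"
  proof -
    interpret E: comm_group "ext G D A" by (rule ext_comm_group) simp_all
    have "c' \<cdot> c \<in> mor \<C> D D" using comp_closed[of D C D c c'] by simp
    then have "\<rho> = pull \<C> G A (c' \<cdot> c) \<rho> \<otimes>\<^bsub>ext G D A\<^esub> pull \<C> G A t \<rho>"
      using pull_add[of A D D "c' \<cdot> c" t \<rho>] pull_ident[of A D \<rho>] t \<rho> idD by simp
    moreover have "pull \<C> G A (c' \<cdot> c) \<rho> = \<rho>"
      using pull_comp[of A D C D c' c \<rho>] \<rho> c'\<rho> by (simp add: defs(5))
    moreover have "pull \<C> G A t \<rho> \<in> carrier (ext G D A)"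
      using pull_closed[of A D D t \<rho>] t \<rho> by simp
    ultimately show ?thesis using \<rho> by simp
  qed
  then obtain \<tau> where \<tau>: "\<tau> \<in> mor \<C> D (cob B n)" "cdf B n \<cdot> \<tau> = t"
    using exangle_lift_end[OF R1[OF B], of D t] t B0 B1 by auto
  have ii: "ID A \<cdot> ID A = ID A" using comp_ident_left[of A A "ID A"] by (simp add: ident_closed)
  have "\<tau> \<in> mor \<C> (cob Q (Suc n)) (cob B n)" "\<sigma> \<in> mor \<C> (cob B (Suc n)) (cob Q n)"
    using \<tau>(1) \<sigma> B1 by (simp_all add: defs)
  note ends =
    chain_map_add_end[OF Q Bc chain_map_comp[OF Q Nc Bc \<iota> a(1)] \<open>n \<ge> 1\<close> this(1)]
    chain_map_add_end[OF Bc Q chain_map_comp[OF Bc Nc Q b(1) \<pi>] \<open>n \<ge> 1\<close> this(2)]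
  have "n \<noteq> 0" using \<open>n \<ge> 1\<close> by simp
  obtain \<alpha> where "chain_map_between n \<C> A D Q B \<alpha>"
    using that[of "\<lambda>i. if i = n then madd \<C> (cob Q n) (cob B n) (a n \<cdot> \<iota> n) (\<tau> \<cdot> cdf Q n)
         else if i = Suc n then madd \<C> (cob Q (Suc n)) (cob B (Suc n)) (a (Suc n) \<cdot> \<iota> (Suc n)) (cdf B n \<cdot> \<tau>)
         else a i \<cdot> \<iota> i"] ends(1) A(3) a(2,3) B1 idD ii \<tau>(2) \<open>n \<noteq> 0\<close>
    unfolding chain_map_between_def by (simp add: defs(1,4))
  moreover obtain \<beta> where "chain_map_between n \<C> A D B Q \<beta>"
    using that[of "\<lambda>i. if i = n then madd \<C> (cob B n) (cob Q n) (\<pi> n \<cdot> b n) (\<sigma> \<cdot> cdf B n)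
         else if i = Suc n then madd \<C> (cob B (Suc n)) (cob Q (Suc n)) (\<pi> (Suc n) \<cdot> b (Suc n)) (cdf Q n \<cdot> \<sigma>)
         else \<pi> i \<cdot> b i"] ends(2) A(4) b(2,3) B1 idD ii t_def \<open>n \<noteq> 0\<close>
    unfolding chain_map_between_def by (simp add: defs(2,4))
  moreover have "middle_exact n B" and "middle_exact n N"
    using R1[OF B] R1[OF N] exangle_middle_exact by auto
  moreover from this(2) have "middle_exact n Q"
    by (rule middle_exact_homotopy_retract[OF _ Q \<iota> \<pi> retract])
  ultimately have "hclass n \<C> Q = hclass n \<C> B"
    using hclass_eqI[of n Q B A D \<alpha> \<beta>] A B0 B1 by (simp add: defs)
  then show ?thesis
    using B B0 B1 A Q \<rho> by (simp add: distinguished_def flip: defs)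
qed

end

section \<open>Cancelling a summand\<close>

context additive_category
begin

lemma dsum_biproduct:
  assumes "X \<in> Ob" "Y \<in> Ob"
  shows "biproduct \<C> X Y (dsum \<C> X Y) (inj1 \<C> X Y) (inj2 \<C> X Y) (proj1 \<C> X Y) (proj2 \<C> X Y)"
proof -
  have "\<exists>b. case b of (S, i, j, p, q) \<Rightarrow> biproduct \<C> X Y S i j p q"
    using ex_biproduct[OF assms] by auto
  then have "case chosen_biproduct \<C> X Y of (S, i, j, p, q) \<Rightarrow> biproduct \<C> X Y S i j p q"
    unfolding chosen_biproduct_def by (rule someI_ex)
  then show ?thesis
    by (simp add: dsum_def inj1_def inj2_def proj1_def proj2_def split: prod.splits)
qed

lemma biproduct_shear:
  assumes "biproduct \<C> X Y S i j p q" "X \<in> Ob" "Y \<in> Ob" and g: "g \<in> mor \<C> Y X"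
  shows "biproduct \<C> X Y S i (madd \<C> Y S (i \<cdot> g) j) (madd \<C> S X p (mneg \<C> S X (g \<cdot> q))) q"
proof -
  have [simp]: "S \<in> Ob" "i \<in> mor \<C> X S" "j \<in> mor \<C> Y S" "p \<in> mor \<C> S X" "q \<in> mor \<C> S Y"
    and eqs [simp]: "cmp X S X p i = ID X" "cmp Y S Y q j = ID Y" "cmp Y S X p j = mzero \<C> Y X"
      "cmp X S Y q i = mzero \<C> X Y"
    and sum: "madd \<C> S S (cmp S X S i p) (cmp S Y S j q) = ID S"
    using assms(1) by (auto simp: biproduct_def cmp_def)
  note [simp] = assms(2-4) hom_closed
  have c: "cmp W S X p (cmp W X S i z) = z" "cmp W S Y q (cmp W X S i z) = mzero \<C> W Y"
    if "W \<in> Ob" "z \<in> mor \<C> W X" for W z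
    using that by (simp_all add: cmp_ident cmp_zero flip: cmp_assoc)
  let ?j = "madd \<C> Y S (cmp Y X S i g) j"
  let ?p = "madd \<C> S X p (mneg \<C> S X (cmp S Y X g q))"
  have "cmp X S X ?p i = ID X" "cmp Y S Y q ?j = ID Y" "cmp Y S X ?p ?j = mzero \<C> Y X"
    by (simp_all add: hom_simps c)
  moreover have "madd \<C> S S (cmp S X S i ?p) (cmp S Y S ?j q) = ID S"
    unfolding sum[symmetric] by (simp add: hom_simps hom_add_comm hom_add_left_comm)
  moreover have "?j \<in> mor \<C> Y S" "?p \<in> mor \<C> S X" by simp_all
  ultimately show ?thesis
    using eqs(4) by (simp add: biproduct_def cmp_def)
qed

text \<open>
  With composites associated to the right, an equation \<open>g f = h\<close> does not match inside \<open>g (f z)\<close>;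
  this form of it does.
\<close>

lemma cmp_reassoc:
  assumes "cmp X Y Z g f = h" "W \<in> Ob" "X \<in> Ob" "Y \<in> Ob" "Z \<in> Ob"
    "z \<in> mor \<C> W X" "f \<in> mor \<C> X Y" "g \<in> mor \<C> Y Z"
  shows "cmp W Y Z g (cmp W X Y f z) = cmp W X Z h z"
  using assms by (simp flip: cmp_assoc)

lemma biproduct_cmp:
  assumes "biproduct \<C> X Y S i j p q"
  shows "S \<in> Ob" "i \<in> mor \<C> X S" "j \<in> mor \<C> Y S" "p \<in> mor \<C> S X" "q \<in> mor \<C> S Y"
    and "cmp X S X p i = ID X" "cmp Y S Y q j = ID Y"
    and "cmp Y S X p j = mzero \<C> Y X" "cmp X S Y q i = mzero \<C> X Y"
    and "madd \<C> S S (cmp S X S i p) (cmp S Y S j q) = ID S"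
  using assms by (auto simp: biproduct_def cmp_def)

end

text \<open>
  A conflation whose first differential lands in the summand \<open>Y\<close> of a biproduct of \<open>Z\<close> and \<open>Y\<close>. The
  map \<open>u\<close> exists in this situation, by exactness at \<open>N\<^sub>1\<close>; it is fixed once and for all, because both
  constructions below use it.
\<close>

locale conflation_through_summand = exact_realisation n \<C> G r
  for n :: nat and \<C> :: "('o, 'm) precat" (structure)
    and G :: "('o, 'm, 'e) bifun" and r :: "('o, 'm, 'e) realisation" +
  fixes N :: "('o, 'm) cpx" and \<epsilon> :: 'e and X Y Z :: 'o and i j p q f u :: 'm
  assumes n: "n \<ge> 1" and N: "distinguished n \<C> G r N \<epsilon>" and N0: "cob N 0 = X"
    and obj [simp]: "X \<in> Ob" "Y \<in> Ob" "Z \<in> Ob"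
    and biprod: "biproduct \<C> Z Y (cob N (Suc 0)) i j p q"
    and f [simp]: "f \<in> mor \<C> X Y" and d0: "cdf N 0 = j \<cdot> f"
    and u [simp]: "u \<in> mor \<C> (cob N (Suc (Suc 0))) Z"
    and ud: "u \<cdot> cdf N (Suc 0) = p"
begin

abbreviation "N1 \<equiv> cob N (Suc 0)"
abbreviation "N2 \<equiv> cob N (Suc (Suc 0))"
abbreviation "d1 \<equiv> cdf N (Suc 0)"

text \<open>
  \<open>s\<close> is a section of \<open>u\<close>, and \<open>e = 1 - su\<close> is the complementary idempotent, the projection of
  \<open>N\<^sub>2\<close> away from \<open>Z\<close>, which need not split.
\<close>

definition "s = cmp Z N1 N2 d1 i"
definition "e = madd \<C> N2 N2 (ID N2) (mneg \<C> N2 N2 (cmp N2 Z N2 s u))"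

lemma N_complex: "is_complex n \<C> N"
  using N by (simp add: distinguished_def)

lemmas N_ob [simp] = is_complexD(1)[OF N_complex]
lemmas N_d [simp] = is_complexD(2)[OF N_complex]
lemmas biprod_simps [simp] = biproduct_cmp(1-9)[OF biprod]

lemma N_low [simp]: "N2 \<in> Ob" "d1 \<in> mor \<C> N1 N2"
  using n is_complexD(1)[OF N_complex, of "Suc (Suc 0)"] is_complexD(2)[OF N_complex, of "Suc 0"]
  by simp_all

lemma s_mor [simp]: "s \<in> mor \<C> Z N2"
  by (simp add: s_def hom_closed)

lemma e_mor [simp]: "e \<in> mor \<C> N2 N2"
  by (simp add: e_def hom_closed)

lemma u_d1: "cmp N1 N2 Z u d1 = p"
  using ud by (simp add: cmp_def)

lemma u_s: "cmp Z N2 Z u s = ID Z"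
  by (simp add: s_def cmp_reassoc[OF u_d1])

lemma d0_cmp: "cdf N 0 = cmp X Y N1 j f"
  using d0 by (simp add: cmp_def)

lemma e_s: "cmp Z N2 N2 e s = mzero \<C> Z N2"
  by (simp add: e_def hom_simps u_s)

lemma u_e: "cmp N2 N2 Z u e = mzero \<C> N2 Z"
  by (simp add: e_def hom_simps cmp_reassoc[OF u_s])

lemma id_N2: "madd \<C> N2 N2 e (cmp N2 Z N2 s u) = ID N2"
  by (simp add: e_def hom_simps)

lemma d1_decomposition: "d1 = madd \<C> N1 N2 (cmp N1 Z N2 s p) (cmp N1 Y N2 (cmp Y N1 N2 d1 j) q)"
proof -
  have "d1 = cmp N1 N1 N2 d1 (madd \<C> N1 N1 (cmp N1 Z N1 i p) (cmp N1 Y N1 j q))"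
    by (simp add: biproduct_cmp(10)[OF biprod] cmp_ident)
  also have "\<dots> = madd \<C> N1 N2 (cmp N1 Z N2 s p) (cmp N1 Y N2 (cmp Y N1 N2 d1 j) q)"
    by (simp add: s_def hom_simps)
  finally show ?thesis .
qed

lemma e_d1: "cmp N1 N2 N2 e d1 = cmp N1 Y N2 (cmp Y N1 N2 d1 j) q"
proof -
  have "cmp N1 N2 N2 e d1 = madd \<C> N1 N2 d1 (mneg \<C> N1 N2 (cmp N1 Z N2 s p))"
    by (simp add: e_def hom_simps u_d1)
  moreover have "\<dots> = cmp N1 Y N2 (cmp Y N1 N2 d1 j) q"
    by (subst hom_diff_eq_iff) (simp_all add: hom_closed flip: d1_decomposition)
  ultimately show ?thesis by simp
qed

lemma d1_j_f: "cmp X Y N2 (cmp Y N1 N2 d1 j) f = mzero \<C> X N2"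
  using is_complex_cmp[OF N_complex, of 0] n by (simp add: N0 d0_cmp cmp_assoc)

lemma e_d1_j: "cmp Y N2 N2 e (cmp Y N1 N2 d1 j) = cmp Y N1 N2 d1 j"
  by (simp add: cmp_reassoc[OF e_d1] hom_simps)

lemma \<epsilon>_closed: "\<epsilon> \<in> carrier (ext G (cob N (Suc n)) X)"
  using N by (simp add: distinguished_def N0)

text \<open>
  The kernel \<open>K\<close> of \<open>u\<close> splits \<open>e\<close>, and \<open>Q\<close> is \<open>X \<rightarrow> Y \<rightarrow> K\<close>. It is even a strict retract of \<open>N\<close>. The last
  components compose to \<open>e = 1 - su\<close> on \<open>N\<^sub>2\<close>, which fixes \<open>\<epsilon>\<close> because \<open>s\<close> factors through \<open>d\<^sub>1\<close> and
  \<open>d\<^sub>1\<^sup>*\<epsilon> = 0\<close>.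
\<close>

lemma inflation_if_weakly_idempotent_complete:
  assumes "n = 1" and "weakly_idempotent_complete \<C>"
  shows "inflation n \<C> G r X Y f"
proof -
  have n1: "n = Suc 0" using assms by simp
  have "retraction \<C> N2 Z u"
    using u_s by (auto simp: retraction_def cmp_def intro!: bexI[of _ s])
  then obtain K k where K: "is_kernel \<C> N2 Z u K k"
    using assms(2) unfolding weakly_idempotent_complete_def by (meson N_low(1) obj(3))
  then have [simp]: "K \<in> Ob" "k \<in> mor \<C> K N2" and uk: "cmp K N2 Z u k = mzero \<C> K Z"
    by (auto simp: is_kernel_def cmp_def)
  have kernel: "\<exists>!v. v \<in> mor \<C> T K \<and> cmp T K N2 k v = t"
    if "T \<in> Ob" "t \<in> mor \<C> T N2" "cmp T N2 Z u t = mzero \<C> T Z" for T t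
    using K that by (auto simp: is_kernel_def cmp_def)
  obtain c where c [simp]: "c \<in> mor \<C> N2 K" and kc: "cmp N2 K N2 k c = e"
    using kernel[OF _ e_mor u_e] by auto
  have "cmp K K N2 k (cmp K N2 K c k) = cmp K N2 N2 e k"
    by (simp add: cmp_reassoc[OF kc])
  also have "\<dots> = k"
    by (simp add: e_def hom_simps uk)
  finally have ck: "cmp K N2 K c k = ID K"
    using kernel[OF _ _ uk]
    by (simp add: cmp_ident hom_closed)
      (metis c cmp_closed cmp_ident(1) ident_closed \<open>K \<in> Ob\<close>
        \<open>k \<in> mor \<C> K N2\<close> N_low(1))
  have "cmp Z K N2 k (cmp Z N2 K c s) = mzero \<C> Z N2"
    by (simp add: cmp_reassoc[OF kc] e_s)
  then have cs: "cmp Z N2 K c s = mzero \<C> Z K"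
    using kernel[of Z "mzero \<C> Z N2"]
    by (simp add: hom_simps)
      (metis c cmp_closed cmp_zero(1) hom_zero_closed \<open>K \<in> Ob\<close>
        \<open>k \<in> mor \<C> K N2\<close> N_low(1) obj(3) s_mor)
  define \<delta> where "\<delta> = cmp Y N2 K c (cmp Y N1 N2 d1 j)"
  have \<delta> [simp]: "\<delta> \<in> mor \<C> Y K" by (simp add: \<delta>_def hom_closed)
  define Q where "Q = \<lparr>cob = (\<lambda>m. if m = 0 then X else if m = 1 then Y else K),
    cdf = (\<lambda>m. if m = 0 then f else \<delta>)\<rparr>"
  define \<iota> where "\<iota> = (\<lambda>m::nat. if m = 0 then ID X else if m = 1 then j else k)"
  define \<pi> where "\<pi> = (\<lambda>m::nat. if m = 0 then ID X else if m = 1 then q else c)"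
  have Q: "is_complex n \<C> Q"
  proof -
    have "cmp X Y K \<delta> f = mzero \<C> X K"
      by (simp add: \<delta>_def hom_closed cmp_assoc[of X Y N2 K] d1_j_f cmp_zero)
    then show ?thesis by (auto simp: is_complex_def Q_def n1 cmp_def le_Suc_eq)
  qed
  have "chain_map n \<C> Q N \<iota>"
  proof -
    have "cmp Y K N2 k \<delta> = cmp Y N1 N2 d1 j"
      by (simp add: \<delta>_def hom_closed cmp_reassoc[OF kc] e_d1_j)
    moreover have "cmp X X N1 (cdf N 0) (ID X) = cmp X Y N1 j f"
      by (simp add: d0_cmp cmp_ident hom_closed)
    ultimately show ?thesis
      by (auto simp: chain_map_def Q_def \<iota>_def n1 N0 cmp_def ident_closed le_Suc_eq)
  qed
  moreover have "chain_map n \<C> N Q \<pi>"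
  proof -
    have "cmp N1 N2 K c d1 = cmp N1 Y K \<delta> q"
    proof -
      have "cmp N1 N2 K c d1 = cmp N1 N2 K c
          (madd \<C> N1 N2 (cmp N1 Z N2 s p) (cmp N1 Y N2 (cmp Y N1 N2 d1 j) q))"
        by (simp flip: d1_decomposition)
      also have "\<dots> = cmp N1 Y K \<delta> q"
        by (simp add: \<delta>_def hom_simps cmp_reassoc[OF cs])
      finally show ?thesis .
    qed
    moreover have "cmp X N1 Y q (cdf N 0) = cmp X X Y f (ID X)"
      by (simp add: d0_cmp cmp_reassoc[of Y N1 Y q j] cmp_ident)
    ultimately show ?thesis
      by (auto simp: chain_map_def Q_def \<pi>_def n1 N0 cmp_def ident_closed le_Suc_eq)
  qed
  moreover have "homotopic n \<C> Q Q (\<lambda>m. \<pi> m \<cdot> \<iota> m) (\<lambda>m. ID (cob Q m))"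
  proof -
    have eq: "\<pi> m \<cdot> \<iota> m = ID (cob Q m)" for m
      using ck biprod_simps(7) cmp_ident[of X X "ID X"]
      by (auto simp: \<pi>_def \<iota>_def Q_def cmp_def ident_closed)
    have [simp]: "cob Q m \<in> Ob" for m by (simp add: Q_def)
    have "homotopy n Q Q (\<lambda>m. mzero \<C> (cob Q (Suc m)) (cob Q m)) (\<lambda>m. ID (cob Q m)) (\<lambda>m. ID (cob Q m))"
    proof -
      note [simp] = is_complexD(2)[OF Q]
      have z: "mzero \<C> (cob Q (Suc m)) (cob Q m) \<cdot> cdf Q m = mzero \<C> (cob Q m) (cob Q m)"
        "cdf Q m \<cdot> mzero \<C> (cob Q (Suc m)) (cob Q m) = mzero \<C> (cob Q (Suc m)) (cob Q (Suc m))" if "m \<le> n" for m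
        using cmp_zero(2)[of "cob Q m" "cob Q (Suc m)" "cob Q m" "cdf Q m"]
          cmp_zero(1)[of "cob Q (Suc m)" "cob Q m" "cob Q (Suc m)" "cdf Q m"] that
        by (simp_all add: cmp_def)
      show ?thesis
        by (simp add: homotopy_def z hom_simps)
    qed
    then show ?thesis
      by (subst homotopic_iff_homotopy[OF Q Q]) (auto simp: eq ident_closed)
  qed
  moreover have "pull \<C> G X (\<iota> (Suc n) \<cdot> \<pi> (Suc n)) \<epsilon> = \<epsilon>"
  proof -
    interpret E: comm_group "ext G N2 X" by (rule ext_comm_group) simp_all
    have \<epsilon>: "\<epsilon> \<in> carrier (ext G N2 X)" using \<epsilon>_closed n1 by simp
    have ex: "pull \<C> G X d1 \<epsilon> = \<one>\<^bsub>ext G N1 X\<^esub>"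
      using R1[OF N] by (simp add: exangle_def N0 n1)
    have "pull \<C> G X (cmp N2 Z N2 s u) \<epsilon> = pull \<C> G X (cmp N2 N1 N2 d1 (cmp N2 Z N1 i u)) \<epsilon>"
      by (simp add: s_def cmp_assoc)
    also have "\<dots> = \<one>\<^bsub>ext G N2 X\<^esub>"
      using pull_comp[of X N2 N1 N2 d1 "cmp N2 Z N1 i u" \<epsilon>] pull_zero[of X N1 N2 "cmp N2 Z N1 i u"] \<epsilon>
      by (simp add: cmp_def[of N2 N1 N2] ex hom_closed)
    finally have "pull \<C> G X (ID N2) \<epsilon> = pull \<C> G X e \<epsilon>"
      using pull_add[of X N2 N2 e "cmp N2 Z N2 s u" \<epsilon>] pull_closed[of X N2 N2 e \<epsilon>] \<epsilon>
      by (simp add: id_N2 hom_closed)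
    moreover have "\<iota> (Suc n) \<cdot> \<pi> (Suc n) = e"
      using kc by (simp add: \<iota>_def \<pi>_def n1 cmp_def)
    ultimately show ?thesis using pull_ident[of X N2 \<epsilon>] \<epsilon> by simp
  qed
  ultimately have "distinguished n \<C> G r Q (pull \<C> G X (\<iota> (Suc n)) \<epsilon>)"
    using N0 by (intro distinguished_homotopy_retract[OF n N Q, where \<pi> = \<pi>])
      (auto simp: Q_def \<iota>_def \<pi>_def)
  then show ?thesis
    unfolding inflation_def conflation_def by (intro exI[of _ Q]) (auto simp: Q_def)
qed

text \<open>
  \<open>Q\<close> is the complex \<open>X \<rightarrow> Y \<rightarrow> N\<^sub>2 \<rightarrow> N\<^sub>3 \<oplus> Z \<rightarrow> N\<^sub>4 \<rightarrow> \<dots>\<close>, whose differential in degree 2 has the entries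
  \<open>d\<^sub>2\<close> and \<open>u\<close>. In degree 2, \<open>1 = e + su\<close>, and \<open>su\<close> is removed by a homotopy from the new summand \<open>Z\<close>
  back to \<open>N\<^sub>2\<close> along \<open>s\<close>, which also accounts for the missing \<open>Z\<close> in degree 3. For \<open>n = 2\<close> the
  end term changes to \<open>N\<^sub>3 \<oplus> Z\<close>, but the composite on \<open>N\<^sub>3\<close> remains the identity.
\<close>

lemma inflation_if_two_le:
  assumes "n \<ge> 2"
  shows "inflation n \<C> G r X Y f"
proof -
  let ?N3 = "cob N 3" and ?d2 = "cdf N 2"
  have N3 [simp]: "?N3 \<in> Ob" and d2 [simp]: "?d2 \<in> mor \<C> N2 ?N3"
    using assms N_ob[of 3] N_d[of 2] by (simp_all add: numeral_eq_Suc)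
  obtain S i' j' p' q' where S: "biproduct \<C> ?N3 Z S i' j' p' q'"
    using ex_biproduct[OF N3 obj(3)] by blast
  note [simp] = biproduct_cmp(1-9)[OF S] hom_closed
  have d2_d1: "cmp N1 N2 ?N3 ?d2 d1 = mzero \<C> N1 ?N3"
    using is_complex_cmp[OF N_complex, of "Suc 0"] assms by (simp add: numeral_eq_Suc)
  have d2_s: "cmp Z N2 ?N3 ?d2 s = mzero \<C> Z ?N3"
    by (simp add: s_def cmp_reassoc[OF d2_d1] hom_simps)
  define \<delta>1 where "\<delta>1 = cmp Y N1 N2 d1 j"
  define \<delta>2 where "\<delta>2 = madd \<C> N2 S (cmp N2 ?N3 S i' ?d2) (cmp N2 Z S j' u)"
  have \<delta> [simp]: "\<delta>1 \<in> mor \<C> Y N2" "\<delta>2 \<in> mor \<C> N2 S" by (simp_all add: \<delta>1_def \<delta>2_def)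
  have p\<delta>2: "cmp N2 S ?N3 p' \<delta>2 = ?d2" and q\<delta>2: "cmp N2 S Z q' \<delta>2 = u"
    by (simp_all add: \<delta>2_def hom_simps cmp_reassoc[OF biproduct_cmp(6)[OF S]]
        cmp_reassoc[OF biproduct_cmp(7)[OF S]] cmp_reassoc[OF biproduct_cmp(8)[OF S]]
        cmp_reassoc[OF biproduct_cmp(9)[OF S]])
  have \<delta>2_s: "cmp Z N2 S \<delta>2 s = j'"
    by (simp add: \<delta>2_def hom_simps d2_s u_s)
  have d2_e: "cmp N2 N2 ?N3 ?d2 e = ?d2"
    by (simp add: e_def hom_simps cmp_reassoc[OF d2_s])
  have \<delta>2_e: "cmp N2 N2 S \<delta>2 e = cmp N2 ?N3 S i' ?d2"
    by (simp add: \<delta>2_def hom_simps d2_e u_e)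
  have p_j: "cmp Y N2 Z u \<delta>1 = mzero \<C> Y Z"
    by (simp add: \<delta>1_def cmp_reassoc[OF u_d1])
  have \<delta>2_\<delta>1: "cmp Y N2 S \<delta>2 \<delta>1 = mzero \<C> Y S"
    by (simp add: \<delta>2_def hom_simps p_j) (simp add: \<delta>1_def cmp_reassoc[OF d2_d1] hom_simps)

  define Q where "Q = \<lparr>cob = (\<lambda>m. if m = 1 then Y else if m = 3 then S else cob N m),
    cdf = (\<lambda>m. if m = 0 then f else if m = 1 then \<delta>1 else if m = 2 then \<delta>2
      else if m = 3 then cmp S ?N3 (cob N 4) (cdf N 3) p' else cdf N m)\<rparr>"
  define \<iota> where "\<iota> = (\<lambda>m::nat. if m = 1 then j else if m = 3 then p' else ID (cob N m))"
  define \<pi> where "\<pi> = (\<lambda>m::nat. if m = 1 then q else if m = 2 then e else if m = 3 then i'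
     else ID (cob N m))"
  define h where "h = (\<lambda>m. if m = 2 then cmp S Z N2 s q' else mzero \<C> (cob Q (Suc m)) (cob Q m))"
  have cases: thesis if "m = 0 \<Longrightarrow> thesis" "m = 1 \<Longrightarrow> thesis" "m = 2 \<Longrightarrow> thesis" "m = 3 \<Longrightarrow> thesis"
    "m > 3 \<Longrightarrow> thesis" for m :: nat and thesis
    using that by linarith
  have N4 [simp]: "cob N 4 \<in> Ob" "cdf N 3 \<in> mor \<C> ?N3 (cob N 4)" if "n \<ge> 3"
    using that N_ob[of 4] N_d[of 3] by (simp_all add: numeral_eq_Suc)
  have [simp]: "cob N 2 = N2" by (simp add: numeral_2_eq_2)
  have Q_ob [simp]: "cob Q m \<in> Ob" if "m \<le> Suc n" for m
    using that by (simp add: Q_def)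
  have Q_d [simp]: "cdf Q m \<in> mor \<C> (cob Q m) (cob Q (Suc m))" if "m \<le> n" for m
    using that by (cases m rule: cases) (simp_all add: Q_def N0)
  have Q: "is_complex n \<C> Q"
  proof -
    have "cmp (cob Q m) (cob Q (Suc m)) (cob Q (Suc (Suc m))) (cdf Q (Suc m)) (cdf Q m)
      = mzero \<C> (cob Q m) (cob Q (Suc (Suc m)))" if "m < n" for m
    proof (cases m rule: cases)
      case 3
      then show ?thesis
        using is_complex_cmp[OF N_complex, of 2] that
        by (simp add: Q_def hom_simps p\<delta>2)
    next
      case 4
      then show ?thesis
        using is_complex_cmp[OF N_complex, of 3] that N_ob[of 5] N_d[of 4]
        by (simp add: Q_def cmp_reassoc hom_simps)
    next
      case 5
      then show ?thesis
        using is_complex_cmp[OF N_complex, of m] that by (simp add: Q_def)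
    qed (use that in \<open>simp_all add: Q_def N0 \<delta>1_def d1_j_f \<delta>2_\<delta>1[unfolded \<delta>1_def]\<close>)
    then show ?thesis by (simp add: is_complex_def cmp_def)
  qed
  have \<iota>: "chain_map n \<C> Q N \<iota>"
  proof (rule chain_mapI)
    show "\<iota> m \<in> mor \<C> (cob Q m) (cob N m)" if "m \<le> Suc n" for m
      using that by (simp add: \<iota>_def Q_def)
    fix m assume "m \<le> n"
    then have "cmp (cob Q m) (cob Q (Suc m)) (cob N (Suc m)) (\<iota> (Suc m)) (cdf Q m)
      = cmp (cob Q m) (cob N m) (cob N (Suc m)) (cdf N m) (\<iota> m)"
      by (cases m rule: cases)
        (simp_all add: Q_def \<iota>_def N0 d0_cmp \<delta>1_def p\<delta>2 hom_simps)
    then show "\<iota> (Suc m) \<cdot> cdf Q m = cdf N m \<cdot> \<iota> m" by (simp add: cmp_def)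
  qed
  have \<pi>: "chain_map n \<C> N Q \<pi>"
  proof (rule chain_mapI)
    show "\<pi> m \<in> mor \<C> (cob N m) (cob Q m)" if "m \<le> Suc n" for m
      using that by (simp add: \<pi>_def Q_def)
    fix m assume "m \<le> n"
    then have "cmp (cob N m) (cob N (Suc m)) (cob Q (Suc m)) (\<pi> (Suc m)) (cdf N m)
      = cmp (cob N m) (cob Q m) (cob Q (Suc m)) (cdf Q m) (\<pi> m)"
      by (cases m rule: cases)
        (simp_all add: Q_def \<pi>_def N0 d0_cmp \<delta>1_def e_d1 \<delta>2_e hom_simps
          cmp_reassoc[OF biproduct_cmp(7)[OF biprod]] cmp_reassoc[OF biproduct_cmp(6)[OF S]])
    then show "\<pi> (Suc m) \<cdot> cdf N m = cdf Q m \<cdot> \<pi> m" by (simp add: cmp_def)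
  qed
  have hm: "h m \<in> mor \<C> (cob Q (Suc m)) (cob Q m)" if "m \<le> n" for m
    using that by (simp add: h_def) (simp add: Q_def)
  have "homotopy n Q Q h (\<lambda>m. ID (cob Q m)) (\<lambda>m. \<pi> m \<cdot> \<iota> m)"
  proof -
    have "cmp (cob Q 0) (cob N 0) (cob Q 0) (\<pi> 0) (\<iota> 0) = ID X"
      by (simp add: Q_def \<pi>_def \<iota>_def N0 cmp_ident)
    moreover have "cmp (cob Q 0) (cob Q (Suc 0)) (cob Q 0) (h 0) (cdf Q 0) = mzero \<C> (cob Q 0) (cob Q 0)"
      using n by (simp add: h_def cmp_zero)
    moreover have "ID (cob Q (Suc m)) = madd \<C> (cob Q (Suc m)) (cob Q (Suc m))
         (cmp (cob Q (Suc m)) (cob N (Suc m)) (cob Q (Suc m)) (\<pi> (Suc m)) (\<iota> (Suc m)))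
         (madd \<C> (cob Q (Suc m)) (cob Q (Suc m))
           (cmp (cob Q (Suc m)) (cob Q m) (cob Q (Suc m)) (cdf Q m) (h m))
           (cmp (cob Q (Suc m)) (cob Q (Suc (Suc m))) (cob Q (Suc m)) (h (Suc m)) (cdf Q (Suc m))))"
      if "m < n" for m
    proof -
      have z: "cmp (cob Q (Suc m)) (cob Q m) (cob Q (Suc m)) (cdf Q m) (h m)
          = mzero \<C> (cob Q (Suc m)) (cob Q (Suc m))" if "m \<noteq> 2"
        using that \<open>m < n\<close> by (simp add: h_def cmp_zero)
      have z': "cmp (cob Q (Suc m)) (cob Q (Suc (Suc m))) (cob Q (Suc m)) (h (Suc m)) (cdf Q (Suc m))
          = mzero \<C> (cob Q (Suc m)) (cob Q (Suc m))" if "m \<noteq> 1"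
        using that \<open>m < n\<close> by (simp add: h_def cmp_zero)
      consider "m = 1" | "m = 2" | "m \<noteq> 1" "m \<noteq> 2" by blast
      then show ?thesis
      proof cases
        case 1
        then show ?thesis
          by (simp add: z) (simp add: Q_def \<pi>_def \<iota>_def h_def hom_simps q\<delta>2 id_N2)
      next
        case 2
        then show ?thesis
          using that by (simp add: Q_def \<pi>_def \<iota>_def h_def hom_simps cmp_reassoc[OF \<delta>2_s]
              biproduct_cmp(10)[OF S])
      next
        case 3
        then have "cmp (cob Q (Suc m)) (cob N (Suc m)) (cob Q (Suc m)) (\<pi> (Suc m)) (\<iota> (Suc m))
          = ID (cob Q (Suc m))"
          using that by (simp add: Q_def \<pi>_def \<iota>_def cmp_ident)
        then show ?thesis
          using 3 that by (simp add: z z' hom_add_zero)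
      qed
    qed
    moreover have "ID (cob Q (Suc n)) = madd \<C> (cob Q (Suc n)) (cob Q (Suc n))
         (cmp (cob Q (Suc n)) (cob N (Suc n)) (cob Q (Suc n)) (\<pi> (Suc n)) (\<iota> (Suc n)))
         (cmp (cob Q (Suc n)) (cob Q n) (cob Q (Suc n)) (cdf Q n) (h n))"
    proof (cases "n = 2")
      case True
      then show ?thesis
        by (simp add: Q_def \<pi>_def \<iota>_def h_def hom_simps cmp_reassoc[OF \<delta>2_s] biproduct_cmp(10)[OF S])
    next
      case False
      then have "cmp (cob Q (Suc n)) (cob Q n) (cob Q (Suc n)) (cdf Q n) (h n)
          = mzero \<C> (cob Q (Suc n)) (cob Q (Suc n))"
        by (simp add: h_def cmp_zero)
      then show ?thesis
        using False assms by (simp add: Q_def \<pi>_def \<iota>_def hom_simps)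
    qed
    ultimately show ?thesis
      using hm by (simp add: homotopy_def cmp_def hom_add_zero ident_closed)
        (simp add: Q_def N0 hom_add_zero ident_closed)
  qed
  moreover have \<pi>\<iota>: "\<pi> m \<cdot> \<iota> m \<in> mor \<C> (cob Q m) (cob Q m)" if "m \<le> Suc n" for m
    using that comp_closed[of "cob Q m" "cob N m" "cob Q m"] chain_mapD(1)[OF \<iota>] chain_mapD(1)[OF \<pi>]
    by simp
  ultimately have "homotopic n \<C> Q Q (\<lambda>m. ID (cob Q m)) (\<lambda>m. \<pi> m \<cdot> \<iota> m)"
    by (subst homotopic_iff_homotopy[OF Q Q]) auto
  then have retract: "homotopic n \<C> Q Q (\<lambda>m. \<pi> m \<cdot> \<iota> m) (\<lambda>m. ID (cob Q m))"
    by (rule homotopic_sym[OF Q Q, rotated 2]) (simp_all add: \<pi>\<iota>)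
  have "cmp (cob N (Suc n)) (cob Q (Suc n)) (cob N (Suc n)) (\<iota> (Suc n)) (\<pi> (Suc n)) = ID (cob N (Suc n))"
    using assms by (cases "n = 2") (simp_all add: Q_def \<iota>_def \<pi>_def cmp_ident)
  then have "pull \<C> G X (\<iota> (Suc n) \<cdot> \<pi> (Suc n)) \<epsilon> = \<epsilon>"
    using pull_ident[of X "cob N (Suc n)" \<epsilon>] \<epsilon>_closed by (simp add: cmp_def)
  then have "distinguished n \<C> G r Q (pull \<C> G X (\<iota> (Suc n)) \<epsilon>)"
    using N0 by (intro distinguished_homotopy_retract[OF n N Q \<iota> \<pi> _ _ _ _ retract])
      (auto simp: Q_def \<iota>_def \<pi>_def)
  then show ?thesis
    unfolding inflation_def conflation_def by (intro exI[of _ Q]) (auto simp: Q_def N0)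
qed

end


theorem theorem2:
  fixes n :: nat
    and \<C> :: "('o, 'm) precat"
    and \<E> :: "('o, 'm, 'e) bifun"
    and \<s> :: "('o, 'm, 'e) realisation"
    and X Y Z :: 'o and f g :: 'm
  assumes "n \<ge> 1"
    and "n_exangulated_category n \<C> \<E> \<s>"
    and "weakly_idempotent_complete \<C> \<or> n \<ge> 2"
    and "X \<in> objects \<C>" and "Y \<in> objects \<C>" and "Z \<in> objects \<C>"
    and "f \<in> mor \<C> X Y" and "g \<in> mor \<C> Y Z"
    and "inflation n \<C> \<E> \<s> X Z (g \<cdot>\<^bsub>\<C>\<^esub> f)"
  shows "inflation n \<C> \<E> \<s> X Y f"
proof -
  interpret n_exangulated_category n \<C> \<E> \<s> by fact
  note ob [simp] = assms(4-6) and [simp] = assms(7,8) hom_closed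
  obtain W \<delta> where W: "distinguished n \<C> \<E> \<s> W \<delta>"
    and W0: "cob W 0 = X" "cob W (Suc 0) = Z" "cdf W 0 = g \<cdot>\<^bsub>\<C>\<^esub> f"
    using assms(9) by (auto simp: inflation_def conflation_def)
  define C where "C = cob W (Suc n)"
  have C [simp]: "C \<in> objects \<C>" and \<delta>: "\<delta> \<in> carrier (ext \<E> C X)"
    using W W0 is_complexD(1)[of n \<C> W "Suc n"] by (auto simp: distinguished_def C_def)
  obtain V where V: "distinguished n \<C> \<E> \<s> V (push \<C> \<E> C f \<delta>)"
    and V0: "cob V 0 = Y" "cob V (Suc n) = C"
    using distinguishedE[OF C ob(2) push_closed[OF ob(1,2) C assms(7) \<delta>]] by auto
  obtain \<phi> where \<phi>0: "\<phi> 0 = f"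
    and N: "distinguished n \<C> \<E> \<s> (coneN n \<C> W V \<phi>) (pull \<C> \<E> X (cdf V n) \<delta>)"
    using EA2_op[of f W V C \<delta>] W V W0 V0 assms(7) by (auto simp: C_def)
  let ?N = "coneN n \<C> W V \<phi>"
  let ?i = "inj1 \<C> Z Y" and ?j = "inj2 \<C> Z Y" and ?p = "proj1 \<C> Z Y" and ?q = "proj2 \<C> Z Y"
  let ?S = "dsum \<C> Z Y"
  have N_low: "cob ?N 0 = X" "cob ?N (Suc 0) = ?S"
    and dN: "cdf ?N 0 = col \<C> X Z Y (g \<cdot>\<^bsub>\<C>\<^esub> f) f"
    using assms(1) by (simp_all add: coneN_def W0 V0 \<phi>0)
  note biprod = dsum_biproduct[OF ob(3,2)]
  note [simp] = biproduct_cmp(1-5)[OF biprod]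
  \<comment> \<open>Sheared by \<open>g\<close>, the inclusion of \<open>Y\<close> becomes \<open>(g, 1)\<close>, through which \<open>(gf, f)\<close> factors.\<close>
  define j where "j = madd \<C> Y ?S (?i \<cdot>\<^bsub>\<C>\<^esub> g) ?j"
  define p where "p = madd \<C> ?S Z ?p (mneg \<C> ?S Z (g \<cdot>\<^bsub>\<C>\<^esub> ?q))"
  have shear: "biproduct \<C> Z Y (cob ?N (Suc 0)) ?i j p ?q"
    using biproduct_shear[OF biprod _ _ assms(8)] by (simp add: N_low j_def p_def)
  have d0: "cdf ?N 0 = j \<cdot>\<^bsub>\<C>\<^esub> f"
  proof -
    have "cmp X Y ?S (madd \<C> Y ?S (cmp Y Z ?S ?i g) ?j) f
      = madd \<C> X ?S (cmp X Z ?S ?i (cmp X Y Z g f)) (cmp X Y ?S ?j f)"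
      by (simp add: hom_simps)
    then show ?thesis by (simp add: dN col_def j_def cmp_def)
  qed
  have mid: "middle_exact n ?N" using R1[OF N] by (rule exangle_middle_exact)
  have p: "p \<in> mor \<C> (cob ?N (Suc 0)) Z" using biproduct_cmp(4)[OF shear] .
  have "cmp (cob ?N 0) (cob ?N (Suc 0)) Z p (cdf ?N 0) = mzero \<C> (cob ?N 0) Z"
  proof -
    have "cmp X Y ?S j f = cdf ?N 0" by (simp add: d0 cmp_def)
    then show ?thesis
      using biproduct_cmp[OF shear] cmp_reassoc[OF biproduct_cmp(8)[OF shear], of X f]
      by (simp add: N_low cmp_zero)
  qed
  then obtain u where "u \<in> mor \<C> (cob ?N (Suc (Suc 0))) Z"
    and "p = cmp (cob ?N (Suc 0)) (cob ?N (Suc (Suc 0))) Z u (cdf ?N (Suc 0))"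
    using middle_exactD[OF mid ob(3) _ p] assms(1) by (metis Suc_le_eq One_nat_def)
  then interpret conflation_through_summand n \<C> \<E> \<s> ?N "pull \<C> \<E> X (cdf V n) \<delta>"
    X Y Z ?i j p ?q f u
    using assms(1) N shear d0 by unfold_locales (auto simp: N_low cmp_def)
  show ?thesis
  proof (cases "n \<ge> 2")
    case True
    then show ?thesis by (rule inflation_if_two_le)
  next
    case False
    then show ?thesis using assms(1,3) by (intro inflation_if_weakly_idempotent_complete) auto
  qed
qed

end
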